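(* Let $n\ge2$ and let $U=U_{r,s}(\mathfrak{so}_{2n+1})$ be as in the context, where $r$ is a primitive $d$-th root of unity, $s$ is a primitive $d'$-th root of unity, $r^3\ne s^3$, $r^4\ne s^4$, and $\ell=\mathrm{lcm}(d,d')$. Then the elements $\mathcal E_{k,j}^\ell$ $(1\le k\le j\le n)$, $\mathcal E_{k,j'}^\ell$ $(1\le k<j\le n)$, $\mathcal F_{k,j}^\ell$ $(1\le k\le j\le n)$, $\mathcal F_{k,j'}^\ell$ $(1\le k<j\le n)$ and $\omega_k^\ell-1$, $(\omega_k')^\ell-1$ $(1\le k\le n)$ are central in $U$.
   Context: $\mathbb K=\mathbb Q(r,s)$. $U_{r,s}(\mathfrak{so}_{2n+1})$ is the $\mathbb K$-algebra generated by $e_i,f_i,\omega_i^{\pm1},\omega_i'^{\pm1}$ ($1\le i\le n$) with: $\omega$'s commute, invertible; $\omega_je_i\omega_j^{-1}=\langle\omega_i',\omega_j\rangle e_i$, $\omega_jf_i\omega_j^{-1}=\langle\omega_i',\omega_j\rangle^{-1}f_i$, $\omega_j'e_i\omega_j'^{-1}=\langle\omega_j',\omega_i\rangle^{-1}e_i$, $\omega_j'f_i\omega_j'^{-1}=\langle\omega_j',\omega_i\rangle f_i$, where $\langle\omega_i',\omega_i\rangle=r^2s^{-2}$ ($i<n$), $\langle\omega_n',\omega_n\rangle=rs^{-1}$, $\langle\omega_i',\omega_{i+1}\rangle=r^{-2}$, $\langle\omega_{i+1}',\omega_i\rangle=s^2$ ($i<n$), others $1$; $e_if_j-f_je_i=\delta_{ij}(\omega_i-\omega_i')/(r_i-s_i)$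 ($r_i=r^2,s_i=s^2$ for $i<n$; $r_n=r,s_n=s$); Serre relations $(\mathrm{ad}_le_i)^{1-a_{ij}}(e_j)=0=(\mathrm{ad}_rf_i)^{1-a_{ij}}(f_j)$, $i\ne j$, with $(a_{ij})$ the $B_n$ Cartan matrix ($a_{ii}=2$, $a_{i,i+1}=a_{i+1,i}=-1$ for $i\le n-2$, $a_{n-1,n}=-1$, $a_{n,n-1}=-2$, else $0$), $\mathrm{ad}_l(a)(b)=\sum a_{(1)}bS(a_{(2)})$, $\mathrm{ad}_r(a)(b)=\sum S(a_{(1)})ba_{(2)}$, for the Hopf structure $\Delta(\omega)=\omega\otimes\omega$ on the $\omega$'s, $\Delta(e_i)=e_i\otimes1+\omega_i\otimes e_i$, $\Delta(f_i)=1\otimes f_i+f_i\otimes\omega_i'$, $S(e_i)=-\omega_i^{-1}e_i$, $S(f_i)=-f_i\omega_i'^{-1}$. Root vectors: $\mathcal E_{i,i}=e_i$, $\mathcal E_{i,j}=e_i\mathcal E_{i+1,j}-r^2\mathcal E_{i+1,j}e_i$ ($1\le i<j\le n$), $\mathcal E_{i,n'}=\mathcal E_{i,n}e_n-rs\,e_n\mathcal E_{i,n}$ ($i\le n-1$), $\mathcal E_{i,j'}=\mathcal E_{i,(j+1)'}e_j-s^{-2}e_j\mathcal E_{i,(j+1)'}$ ($1\le i<j\le n-1$); $\mathcal F_{i,i}=f_i$, $\mathcal F_{i,j}=\mathcal F_{i+1,j}f_i-s^2f_i\mathcal F_{i+1,j}$, $\mathcal F_{i,n'}=f_n\mathcal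 F_{i,n}-rs\,\mathcal F_{i,n}f_n$, $\mathcal F_{i,j'}=f_j\mathcal F_{i,(j+1)'}-r^{-2}\mathcal F_{i,(j+1)'}f_j$. *)

theory Defs
  imports Main "HOL-Library.Poly_Mapping"
begin

datatype gen = GE nat | GF nat | GW nat | GWi nat | GW' nat | GW'i nat

datatype word = Word "gen list"

instantiation word :: monoid_add
begin
definition zero_word :: word where "zero_word = Word []"
fun plus_word :: "word \<Rightarrow> word \<Rightarrow> word" where
  "plus_word (Word xs) (Word ys) = Word (xs @ ys)"
instance
proof
  fix a b c :: word
  show "a + b + c = a + (b + c)" by (cases a; cases b; cases c) simp
  show "0 + a = a" by (cases a) (simp add: zero_word_def)
  show "a + 0 = a" by (cases a) (simp add: zero_word_def)
qed
end

text \<open>The free associative 'k-algebra: finitely supported 'k-linear combinations of words,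
  with convolution product (concatenation of words).\<close>
type_synonym 'k freealg = "word \<Rightarrow>\<^sub>0 'k"

definition sc :: "'k::ring_1 \<Rightarrow> 'k freealg" where
  "sc c = Poly_Mapping.single (Word []) c"

definition gn :: "gen \<Rightarrow> 'k::ring_1 freealg" where
  "gn g = Poly_Mapping.single (Word [g]) 1"

abbreviation "ge i \<equiv> gn (GE i)"
abbreviation "gf i \<equiv> gn (GF i)"
abbreviation "gw i \<equiv> gn (GW i)"
abbreviation "gwi i \<equiv> gn (GWi i)"
abbreviation "gw' i \<equiv> gn (GW' i)"
abbreviation "gw'i i \<equiv> gn (GW'i i)"

definition pairing :: "nat \<Rightarrow> 'k::field \<Rightarrow> 'k \<Rightarrow> nat \<Rightarrow> nat \<Rightarrow> 'k" where
  "pairing n r s i j =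
     (if i = j then (if i < n then r^2 * inverse (s^2) else r * inverse s)
      else if j = i + 1 then inverse (r^2)
      else if i = j + 1 then s^2
      else 1)"

definition rr :: "nat \<Rightarrow> 'k::field \<Rightarrow> nat \<Rightarrow> 'k" where
  "rr n r i = (if i < n then r^2 else r)"

definition cartan :: "nat \<Rightarrow> nat \<Rightarrow> nat \<Rightarrow> int" where
  "cartan n i j =
     (if i = j then 2
      else if j = i + 1 \<and> i \<le> n - 2 then -1
      else if i = j + 1 \<and> j \<le> n - 2 then -1
      else if i = n - 1 \<and> j = n then -1
      else if i = n \<and> j = n - 1 then -2
      else 0)"

text \<open>Left adjoint action of e_i and right adjoint action of f_i, unfolded via the Hopf structure:
  ad_l(e_i)(b) = e_i b + \<omega>_i b S(e_i) = e_i b - \<omega>_i b \<omega>_i^{-1} e_i,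
  ad_r(f_i)(b) = b f_i + S(f_i) b \<omega>_i' = b f_i - f_i \<omega>_i'^{-1} b \<omega>_i'.\<close>
definition adl :: "nat \<Rightarrow> 'k::ring_1 freealg \<Rightarrow> 'k freealg" where
  "adl i b = ge i * b - gw i * b * gwi i * ge i"

definition adr :: "nat \<Rightarrow> 'k::ring_1 freealg \<Rightarrow> 'k freealg" where
  "adr i b = b * gf i - gf i * gw'i i * b * gw' i"

definition gen_idx :: "gen \<Rightarrow> nat" where
  "gen_idx g = (case g of GE i \<Rightarrow> i | GF i \<Rightarrow> i | GW i \<Rightarrow> i | GWi i \<Rightarrow> i | GW' i \<Rightarrow> i | GW'i i \<Rightarrow> i)"

text \<open>The set of relators (elements required to vanish). Generators with an index outside
  {1..n} are killed, so that the quotient is generated by the 6n generators only.\<close>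
definition rels :: "nat \<Rightarrow> 'k::field \<Rightarrow> 'k \<Rightarrow> 'k freealg set" where
  "rels n r s =
     {gn g | g. gen_idx g \<notin> {1..n}}
   \<union> (\<Union>i\<in>{1..n}. \<Union>j\<in>{1..n}.
       { gw i * gw j - gw j * gw i, gw i * gw' j - gw' j * gw i, gw' i * gw' j - gw' j * gw' i })
   \<union> (\<Union>i\<in>{1..n}. { gw i * gwi i - 1, gwi i * gw i - 1, gw' i * gw'i i - 1, gw'i i * gw' i - 1 })
   \<union> (\<Union>i\<in>{1..n}. \<Union>j\<in>{1..n}.
       { gw j * ge i * gwi j - sc (pairing n r s i j) * ge i,
         gw j * gf i * gwi j - sc (inverse (pairing n r s i j)) * gf i,
         gw' j * ge i * gw'i j - sc (inverse (pairing n r s j i)) * ge i,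
         gw' j * gf i * gw'i j - sc (pairing n r s j i) * gf i,
         ge i * gf j - gf j * ge i
           - (if i = j then sc (inverse (rr n r i - rr n s i)) * (gw i - gw' i) else 0) })
   \<union> (\<Union>i\<in>{1..n}. \<Union>j\<in>{1..n}. if i = j then {} else
       { (adl i ^^ nat (1 - cartan n i j)) (ge j), (adr i ^^ nat (1 - cartan n i j)) (gf j) })"

inductive_set ideal_gen :: "'a::ring_1 set \<Rightarrow> 'a set" for R where
  base: "x \<in> R \<Longrightarrow> x \<in> ideal_gen R"
| zero: "0 \<in> ideal_gen R"
| add: "x \<in> ideal_gen R \<Longrightarrow> y \<in> ideal_gen R \<Longrightarrow> x + y \<in> ideal_gen R"
| mult: "x \<in> ideal_gen R \<Longrightarrow> a * x * b \<in> ideal_gen R"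

text \<open>U = free algebra / ideal_gen (rels n r s). An element x (a representative in the free algebra)
  is central in U iff [x,y] lies in the ideal for every y.\<close>
definition Ucentral :: "nat \<Rightarrow> 'k::field \<Rightarrow> 'k \<Rightarrow> 'k freealg \<Rightarrow> bool" where
  "Ucentral n r s x \<longleftrightarrow> (\<forall>y. x * y - y * x \<in> ideal_gen (rels n r s))"

text \<open>Eaux m j = \<E>_{j-m, j}.\<close>
primrec Eaux :: "'k::field \<Rightarrow> nat \<Rightarrow> nat \<Rightarrow> 'k freealg" where
  "Eaux r 0 j = ge j"
| "Eaux r (Suc m) j = ge (j - Suc m) * Eaux r m j - sc (r^2) * Eaux r m j * ge (j - Suc m)"

definition Ev :: "'k::field \<Rightarrow> nat \<Rightarrow> nat \<Rightarrow> 'k freealg" where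
  "Ev r k j = Eaux r (j - k) j"

text \<open>Epaux m k = \<E>_{k, (n-m)'}.\<close>
primrec Epaux :: "nat \<Rightarrow> 'k::field \<Rightarrow> 'k \<Rightarrow> nat \<Rightarrow> nat \<Rightarrow> 'k freealg" where
  "Epaux n r s 0 k = Ev r k n * ge n - sc (r * s) * ge n * Ev r k n"
| "Epaux n r s (Suc m) k = Epaux n r s m k * ge (n - Suc m)
      - sc (inverse (s^2)) * ge (n - Suc m) * Epaux n r s m k"

definition Epv :: "nat \<Rightarrow> 'k::field \<Rightarrow> 'k \<Rightarrow> nat \<Rightarrow> nat \<Rightarrow> 'k freealg" where
  "Epv n r s k j = Epaux n r s (n - j) k"

primrec Faux :: "'k::field \<Rightarrow> nat \<Rightarrow> nat \<Rightarrow> 'k freealg" where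
  "Faux s 0 j = gf j"
| "Faux s (Suc m) j = Faux s m j * gf (j - Suc m) - sc (s^2) * gf (j - Suc m) * Faux s m j"

definition Fv :: "'k::field \<Rightarrow> nat \<Rightarrow> nat \<Rightarrow> 'k freealg" where
  "Fv s k j = Faux s (j - k) j"

primrec Fpaux :: "nat \<Rightarrow> 'k::field \<Rightarrow> 'k \<Rightarrow> nat \<Rightarrow> nat \<Rightarrow> 'k freealg" where
  "Fpaux n r s 0 k = gf n * Fv s k n - sc (r * s) * Fv s k n * gf n"
| "Fpaux n r s (Suc m) k = gf (n - Suc m) * Fpaux n r s m k
      - sc (inverse (r^2)) * Fpaux n r s m k * gf (n - Suc m)"

definition Fpv :: "nat \<Rightarrow> 'k::field \<Rightarrow> 'k \<Rightarrow> nat \<Rightarrow> nat \<Rightarrow> 'k freealg" where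
  "Fpv n r s k j = Fpaux n r s (n - j) k"

definition primitive_root :: "nat \<Rightarrow> 'k::field \<Rightarrow> bool" where
  "primitive_root d x \<longleftrightarrow> d > 0 \<and> x ^ d = 1 \<and> (\<forall>k. 0 < k \<and> k < d \<longrightarrow> x ^ k \<noteq> 1)"

end

theory Submission
  imports Defs HOL.Vector_Spaces "HOL-Computational_Algebra.Polynomial"
begin

text \<open>
  Call \<open>y\<close> and \<open>z\<close> \<open>q\<close>-commuting if \<open>y z = c z y\<close> for a scalar \<open>c\<close>. If iterated brackets
  \<open>y \<mapsto> z y - a y z\<close> with distinct \<open>l\<close>-th roots of unity \<open>a\<close> take \<open>y\<close> to \<open>0\<close>, then \<open>z\<^sup>l\<close> commutes
  with \<open>y\<close>. For a root vector \<open>z\<close> in row \<open>k\<close> (that is, \<open>E\<^sub>k\<^sub>,\<^sub>j\<close> or \<open>E\<^sub>k\<^sub>,\<^sub>j\<^sub>'\<close>) and \<open>y = e\<^sub>i\<close> with \<open>i > k\<close> or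
  \<open>y = f\<^sub>i\<close>, at most three brackets are needed: up to a torus element, the first one leads to a
  neighbour of \<open>z\<close> in its row, to the vector below \<open>z\<close> in row \<open>k + 1\<close>, or to products of two vectors,
  and \<open>z\<close> \<open>q\<close>-commutes with almost all of these. The remaining \<open>e\<^sub>k\<close> and \<open>e\<^sub>k\<^sub>-\<^sub>1\<close> are reached through
  commutators: the commutator of a vector of row \<open>m\<close> with a suitable \<open>f\<^sub>i\<close>, \<open>i > m\<close>, is its
  predecessor in the row times a unit, so commuting with any vector of row \<open>m\<close> and with these \<open>f\<^sub>i\<close>
  implies commuting with \<open>e\<^sub>m\<close>; and the last vector of row \<open>k - 1\<close> \<open>q\<close>-commutes with everything in
  row \<open>k\<close>. The vectors \<open>F\<close> are the vectors \<open>E\<close> of the opposite algebra with \<open>r\<close> and \<open>s\<close> exchanged.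
\<close>

section \<open>Brackets and q-commutation\<close>

locale scalar_algebra = vector_space scale
  for scale :: "'k::field \<Rightarrow> 'a::ring_1 \<Rightarrow> 'a" (infixr "\<star>" 75) +
  assumes scale_mult_left: "(c \<star> x) * y = c \<star> (x * y)"
    and scale_mult_right: "x * (c \<star> y) = c \<star> (x * y)"
begin

lemmas scale_mult_simps = scale_mult_left scale_mult_right algebra_simps

definition qbracket :: "'a \<Rightarrow> 'a \<Rightarrow> 'k \<Rightarrow> 'a" ("[_, _]\<^bsub>_\<^esub>") where
  "[x, y]\<^bsub>c\<^esub> = x * y - c \<star> (y * x)"

definition qcommute :: "'k \<Rightarrow> 'a \<Rightarrow> 'a \<Rightarrow> bool" where
  "qcommute c x y \<longleftrightarrow> x * y = c \<star> (y * x)"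

lemma qbracket_eq_0_iff: "[x, y]\<^bsub>c\<^esub> = 0 \<longleftrightarrow> qcommute c x y"
  by (simp add: qbracket_def qcommute_def)

lemma qcommute_1_iff: "qcommute 1 x y \<longleftrightarrow> x * y = y * x"
  by (simp add: qcommute_def)

lemma qbracket_0 [simp]: "[0, x]\<^bsub>c\<^esub> = 0" "[x, 0]\<^bsub>c\<^esub> = 0"
  by (simp_all add: qbracket_def)

lemma qbracket_scale: "[d \<star> x, y]\<^bsub>c\<^esub> = d \<star> [x, y]\<^bsub>c\<^esub>" "[x, d \<star> y]\<^bsub>c\<^esub> = d \<star> [x, y]\<^bsub>c\<^esub>"
  by (simp_all add: qbracket_def scale_mult_simps)

lemma qbracket_add_left: "[x + y, z]\<^bsub>c\<^esub> = [x, z]\<^bsub>c\<^esub> + [y, z]\<^bsub>c\<^esub>"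
  and qbracket_add_right: "[x, y + z]\<^bsub>c\<^esub> = [x, y]\<^bsub>c\<^esub> + [x, z]\<^bsub>c\<^esub>"
  and qbracket_diff_left: "[x - y, z]\<^bsub>c\<^esub> = [x, z]\<^bsub>c\<^esub> - [y, z]\<^bsub>c\<^esub>"
  by (simp_all add: qbracket_def scale_mult_simps)

lemma qbracket_mult_left: "[x * y, z]\<^bsub>a * b\<^esub> = x * [y, z]\<^bsub>b\<^esub> + b \<star> ([x, z]\<^bsub>a\<^esub> * y)"
  by (simp add: qbracket_def scale_mult_simps)

lemma qbracket_mult_right: "[x, y * z]\<^bsub>a * b\<^esub> = [x, y]\<^bsub>a\<^esub> * z + a \<star> (y * [x, z]\<^bsub>b\<^esub>)"
  by (simp add: qbracket_def scale_mult_simps)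

lemma qbracket_qbracket_derivation: "[[x, y]\<^bsub>c\<^esub>, z]\<^bsub>1\<^esub> = [[x, z]\<^bsub>1\<^esub>, y]\<^bsub>c\<^esub> + [x, [y, z]\<^bsub>1\<^esub>]\<^bsub>c\<^esub>"
  by (simp add: qbracket_def scale_mult_simps)

lemma qbracket_swap:
  assumes "a * b = 1"
  shows "[x, y]\<^bsub>a\<^esub> = - a \<star> [y, x]\<^bsub>b\<^esub>"
  using assms by (simp add: qbracket_def scale_mult_simps)

lemma qbracket_assoc:
  assumes "qcommute 1 x z"
  shows "[x, [y, z]\<^bsub>b\<^esub>]\<^bsub>a\<^esub> = [[x, y]\<^bsub>a\<^esub>, z]\<^bsub>b\<^esub>"
proof -
  have "[x, [y, z]\<^bsub>b\<^esub>]\<^bsub>a\<^esub> - [[x, y]\<^bsub>a\<^esub>, z]\<^bsub>b\<^esub> = a \<star> (y * [x, z]\<^bsub>1\<^esub>) - b \<star> ([x, z]\<^bsub>1\<^esub> * y)"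
    by (simp add: qbracket_def scale_mult_simps)
  then show ?thesis using assms by (simp flip: qbracket_eq_0_iff)
qed

lemma qbracket_left_commute:
  assumes "qcommute 1 x y"
  shows "[x, [y, z]\<^bsub>b\<^esub>]\<^bsub>a\<^esub> = [y, [x, z]\<^bsub>a\<^esub>]\<^bsub>b\<^esub>"
proof -
  have "[x, [y, z]\<^bsub>b\<^esub>]\<^bsub>a\<^esub> - [y, [x, z]\<^bsub>a\<^esub>]\<^bsub>b\<^esub> = [x, y]\<^bsub>1\<^esub> * z - (a * b) \<star> (z * [x, y]\<^bsub>1\<^esub>)"
    by (simp add: qbracket_def scale_mult_simps)
  then show ?thesis using assms by (simp flip: qbracket_eq_0_iff)
qed

lemma qcommute_inverse_iff: "c \<noteq> 0 \<Longrightarrow> qcommute (inverse c) y x \<longleftrightarrow> qcommute c x y"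
  by (auto simp: qcommute_def)

lemma qcommute_1_sym: "qcommute 1 x y \<Longrightarrow> qcommute 1 y x"
  by (simp add: qcommute_def)

lemma qcommute_cong_scalar: "qcommute c x y \<Longrightarrow> c = d \<Longrightarrow> qcommute d x y"
  by simp

lemma qcommute_scale_right: "qcommute c x y \<Longrightarrow> qcommute c x (d \<star> y)"
  and qcommute_minus_right: "qcommute c x y \<Longrightarrow> qcommute c x (- y)"
  and qcommute_diff_right: "qcommute c x y \<Longrightarrow> qcommute c x z \<Longrightarrow> qcommute c x (y - z)"
  by (simp_all add: qcommute_def scale_mult_simps)

lemma qcommute_mult_right:
  assumes "qcommute c x y" "qcommute d x z"
  shows "qcommute (c * d) x (y * z)"
  using assms by (simp add: qbracket_mult_right flip: qbracket_eq_0_iff)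

lemma qcommute_mult_left:
  assumes "qcommute c x z" "qcommute d y z"
  shows "qcommute (c * d) (x * y) z"
  using assms by (simp add: qbracket_mult_left flip: qbracket_eq_0_iff)

lemma qcommute_power_left: "qcommute c x y \<Longrightarrow> qcommute (c ^ m) (x ^ m) y"
proof (induction m)
  case (Suc m)
  then show ?case using qcommute_mult_left[of c x y "c ^ m" "x ^ m"] by simp
qed (simp add: qcommute_def)

lemma power_root_commutes_left: "qcommute c x y \<Longrightarrow> c ^ l = 1 \<Longrightarrow> qcommute 1 (x ^ l) y"
  by (metis qcommute_power_left)

lemma qcommute_1_power: "qcommute 1 y x \<Longrightarrow> qcommute 1 (x ^ l) y"
  using power_root_commutes_left[of 1 x y l] qcommute_1_sym by simp

lemma power_root_commutes_right:
  assumes "qcommute c x y" "c ^ l = 1" "l > 0"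
  shows "qcommute 1 (y ^ l) x"
proof -
  have "c \<noteq> 0" using assms by (auto simp: power_0_left)
  then show ?thesis
    using assms by (intro power_root_commutes_left[of "inverse c"])
      (simp_all add: qcommute_inverse_iff power_inverse)
qed

lemma qcommute_qbracket_right:
  assumes "qcommute c x y" "qcommute d x z"
  shows "qcommute (c * d) x [y, z]\<^bsub>a\<^esub>"
  using qcommute_mult_right[OF assms] qcommute_mult_right[OF assms(2,1)]
  by (simp add: qbracket_def qcommute_diff_right qcommute_scale_right mult.commute)

lemma qcommute_qbracket_right_1:
  shows "qcommute 1 x y \<Longrightarrow> qcommute c x z \<Longrightarrow> qcommute c x [y, z]\<^bsub>a\<^esub>"
    and "qcommute c x y \<Longrightarrow> qcommute 1 x z \<Longrightarrow> qcommute c x [y, z]\<^bsub>a\<^esub>"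
  using qcommute_qbracket_right[of 1 x y c z a] qcommute_qbracket_right[of c x y 1 z a] by simp_all

lemma qcommute_qbracket_left:
  assumes "qcommute c x z" "qcommute d y z"
  shows "qcommute (c * d) [x, y]\<^bsub>a\<^esub> z"
proof -
  have "[[x, y]\<^bsub>a\<^esub>, z]\<^bsub>c * d\<^esub> = [x * y, z]\<^bsub>c * d\<^esub> - a \<star> [y * x, z]\<^bsub>d * c\<^esub>"
    by (simp add: qbracket_def[of x y] qbracket_diff_left qbracket_scale mult.commute)
  then show ?thesis
    using qcommute_mult_left[OF assms] qcommute_mult_left[OF assms(2,1)]
    by (simp flip: qbracket_eq_0_iff)
qed

lemma qbracket_scaled_diff:
  assumes "qcommute a v x" "qcommute b v' x"
  shows "[x, c \<star> (v - v')]\<^bsub>d\<^esub> = c \<star> ((1 - d * a) \<star> (x * v) + (d * b - 1) \<star> (x * v'))"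
    and "[c \<star> (v - v'), x]\<^bsub>d\<^esub> = c \<star> ((a - d) \<star> (x * v) + (d - b) \<star> (x * v'))"
  using assms by (simp_all add: qbracket_def qcommute_def scale_mult_simps)

lemma qcommute_exchange_scalars:
  shows "qcommute b x [x, y]\<^bsub>a\<^esub> \<Longrightarrow> qcommute a x [x, y]\<^bsub>b\<^esub>"
    and "qcommute b [x, y]\<^bsub>a\<^esub> y \<Longrightarrow> qcommute a [x, y]\<^bsub>b\<^esub> y"
  by (simp_all add: qcommute_def qbracket_def scale_mult_simps)

lemma qcommute_cancel_right:
  assumes "qcommute 1 x (c \<star> (y * v))" "qcommute 1 x v" "c \<noteq> 0" "v * v' = 1"
  shows "qcommute 1 x y"
proof -
  have "qcommute 1 x (y * v)"
    using qcommute_scale_right[OF assms(1), of "inverse c"] assms(3) by simp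
  then have "x * y * v = y * v * x" by (simp add: qcommute_1_iff mult.assoc)
  also have "\<dots> = y * x * v" using assms(2) by (simp add: qcommute_1_iff mult.assoc)
  finally have "x * y * (v * v') = y * x * (v * v')" by (simp add: mult.assoc[symmetric])
  then show ?thesis using assms(4) by (simp add: qcommute_1_iff)
qed

lemma qbracket_middle_commutes:
  assumes "qcommute 1 x z" and x_y: "qcommute q [x, y]\<^bsub>p\<^esub> y" and y_z: "qcommute q y [y, z]\<^bsub>p\<^esub>"
    and "p + q \<noteq> 0"
  shows "qcommute 1 y [[x, y]\<^bsub>p\<^esub>, z]\<^bsub>p\<^esub>"
proof -
  define x' z' u where "x' = [x, y]\<^bsub>p\<^esub>" and "z' = [y, z]\<^bsub>p\<^esub>" and "u = [x', z]\<^bsub>p\<^esub>"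
  have u_eq: "u = [x, z']\<^bsub>p\<^esub>"
    unfolding u_def x'_def z'_def by (rule qbracket_assoc[OF assms(1), symmetric])
  have "q \<star> (y * u) - p \<star> (u * y) = x' * z' - (p * q) \<star> (z' * x')"
  proof -
    have "q \<star> (y * u) - p \<star> (u * y) - (x' * z' - (p * q) \<star> (z' * x'))
      = p \<star> (p \<star> (z * [x', y]\<^bsub>q\<^esub>)) - [x', y]\<^bsub>q\<^esub> * z"
      unfolding u_def z'_def by (simp add: qbracket_def scale_mult_simps)
    then show ?thesis using x_y by (simp add: x'_def flip: qbracket_eq_0_iff)
  qed
  moreover have "q \<star> (u * y) - p \<star> (y * u) = x' * z' - (p * q) \<star> (z' * x')"
  proof -
    have "q \<star> (u * y) - p \<star> (y * u) - (x' * z' - (p * q) \<star> (z' * x'))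
      = p \<star> (p \<star> ([y, z']\<^bsub>q\<^esub> * x)) - x * [y, z']\<^bsub>q\<^esub>"
      unfolding u_eq x'_def by (simp add: qbracket_def scale_mult_simps)
    then show ?thesis using y_z by (simp add: z'_def flip: qbracket_eq_0_iff)
  qed
  ultimately have "q \<star> (y * u) - p \<star> (u * y) = q \<star> (u * y) - p \<star> (y * u)" by simp
  then have "(p + q) \<star> (y * u) = (p + q) \<star> (u * y)"
    by (simp add: algebra_simps)
  then show ?thesis using assms(4) by (simp add: qcommute_1_iff u_def x'_def)
qed

lemma qcommute_mixed_qbracket:
  assumes "qcommute c y y'"
  shows "[x, y]\<^bsub>p\<^esub> * y' + p \<star> (y * [x, y']\<^bsub>p\<^esub>) = c \<star> ([x, y']\<^bsub>p\<^esub> * y + p \<star> (y' * [x, y]\<^bsub>p\<^esub>))"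
  using assms by (simp add: qcommute_def qbracket_scale flip: qbracket_mult_right)

lemma qcommute_lift_left:
  assumes "qcommute c y y'" and x_y: "qcommute q x [x, y]\<^bsub>p\<^esub>" and x_y': "qcommute q x [x, y']\<^bsub>p\<^esub>"
    and "p + q \<noteq> 0"
  shows "qcommute c [x, y]\<^bsub>p\<^esub> [x, y']\<^bsub>p\<^esub>"
proof -
  define z z' where "z = [x, y]\<^bsub>p\<^esub>" and "z' = [x, y']\<^bsub>p\<^esub>"
  have "[x, z * y' + p \<star> (y * z')]\<^bsub>p * q\<^esub> = [x, c \<star> (z' * y + p \<star> (y' * z))]\<^bsub>p * q\<^esub>"
    using qcommute_mixed_qbracket[OF assms(1)] by (simp add: z_def z'_def)
  moreover have "[x, z * y']\<^bsub>p * q\<^esub> = q \<star> (z * z')" "[x, z' * y]\<^bsub>p * q\<^esub> = q \<star> (z' * z)"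
    using qbracket_mult_right[of x z y' q p] qbracket_mult_right[of x z' y q p] x_y x_y'
    by (simp_all add: z_def z'_def mult.commute[of q] flip: qbracket_eq_0_iff)
  moreover have "[x, y * z']\<^bsub>p * q\<^esub> = z * z'" "[x, y' * z]\<^bsub>p * q\<^esub> = z' * z"
    using x_y x_y' by (simp_all add: qbracket_mult_right z_def z'_def flip: qbracket_eq_0_iff)
  ultimately have "(p + q) \<star> (z * z') = (p + q) \<star> (c \<star> (z' * z))"
    by (simp add: qbracket_add_right qbracket_scale algebra_simps)
  then have "z * z' = c \<star> (z' * z)" using assms(4) by (simp only: scale_cancel_left simp_thms)
  then show ?thesis by (simp add: qcommute_def z_def z'_def)
qed

lemma qcommute_lift_right:
  assumes "qcommute c y y'" and y_x: "qcommute q [y, x]\<^bsub>p\<^esub> x" and y'_x: "qcommute q [y', x]\<^bsub>p\<^esub> x"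
    and "p + q \<noteq> 0"
  shows "qcommute c [y, x]\<^bsub>p\<^esub> [y', x]\<^bsub>p\<^esub>"
proof -
  define z z' where "z = [y, x]\<^bsub>p\<^esub>" and "z' = [y', x]\<^bsub>p\<^esub>"
  have "[y * y', x]\<^bsub>p * p\<^esub> = [c \<star> (y' * y), x]\<^bsub>p * p\<^esub>"
    using assms(1) by (simp add: qcommute_def)
  then have "y * z' + p \<star> (z * y') = c \<star> (y' * z + p \<star> (z' * y))"
    by (simp add: qbracket_scale qbracket_mult_left z_def z'_def)
  then have "[y * z' + p \<star> (z * y'), x]\<^bsub>p * q\<^esub> = [c \<star> (y' * z + p \<star> (z' * y)), x]\<^bsub>p * q\<^esub>"
    by simp
  moreover have "[y * z', x]\<^bsub>p * q\<^esub> = q \<star> (z * z')" "[y' * z, x]\<^bsub>p * q\<^esub> = q \<star> (z' * z)"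
    using y_x y'_x by (simp_all add: qbracket_mult_left z_def z'_def flip: qbracket_eq_0_iff)
  moreover have "[z * y', x]\<^bsub>p * q\<^esub> = z * z'" "[z' * y, x]\<^bsub>p * q\<^esub> = z' * z"
    using qbracket_mult_left[of z y' x q p] qbracket_mult_left[of z' y x q p] y_x y'_x
    by (simp_all add: z_def z'_def mult.commute[of q] flip: qbracket_eq_0_iff)
  ultimately have "(p + q) \<star> (z * z') = (p + q) \<star> (c \<star> (z' * z))"
    by (simp add: qbracket_add_left qbracket_scale algebra_simps)
  then have "z * z' = c \<star> (z' * z)" using assms(4) by (simp only: scale_cancel_left simp_thms)
  then show ?thesis by (simp add: qcommute_def z_def z'_def)
qed

text \<open>In the applications below \<open>x\<close> and \<open>y\<close> are \<open>e\<^sub>n\<^sub>-\<^sub>1\<close> and \<open>e\<^sub>n\<close>, \<open>z\<close> is \<open>E\<^sub>n\<^sub>-\<^sub>1\<^sub>,\<^sub>n\<close>, \<open>z'\<close> is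
  \<open>E\<^sub>n\<^sub>-\<^sub>1\<^sub>,\<^sub>n\<^sub>'\<close>, \<open>u\<close> is \<open>E\<^sub>k\<^sub>,\<^sub>n\<^sub>-\<^sub>2\<close>, \<open>v\<close> is \<open>E\<^sub>k\<^sub>,\<^sub>n\<close> and \<open>v'\<close> is \<open>E\<^sub>k\<^sub>,\<^sub>n\<^sub>'\<close>.\<close>

lemma rank2_qcommute:
  assumes z_eq: "z = [x, y]\<^bsub>p\<^esub>" and z'_eq: "z' = [z, y]\<^bsub>t\<^esub>"
    and x_z: "qcommute q x z" and z'_y: "qcommute q z' y"
    and t_square: "t * t = p * q" and t_nz: "t \<noteq> 0"
  shows "qcommute q z z'"
proof -
  have "[x, z']\<^bsub>p * q\<^esub> = (q - t) \<star> (z * z)"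
  proof -
    have "[x, z']\<^bsub>p * q\<^esub> = [x, z * y]\<^bsub>q * p\<^esub> - t \<star> [x, y * z]\<^bsub>p * q\<^esub>"
      unfolding z'_eq qbracket_def[of z y t]
      by (simp add: qbracket_def scale_mult_simps)
    moreover have "[x, z * y]\<^bsub>q * p\<^esub> = q \<star> (z * z)" "[x, y * z]\<^bsub>p * q\<^esub> = z * z"
      using x_z unfolding qbracket_mult_right by (simp_all flip: z_eq qbracket_eq_0_iff)
    ultimately show ?thesis by (simp add: scale_left_diff_distrib)
  qed
  then have "[x * z' - (p * q) \<star> (z' * x), y]\<^bsub>p * q\<^esub> = (q - t) \<star> [z * z, y]\<^bsub>t * t\<^esub>"
    by (simp add: qbracket_def[of x] qbracket_scale t_square)
  moreover have "[z * z, y]\<^bsub>t * t\<^esub> = z * z' + t \<star> (z' * z)"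
    by (simp add: qbracket_mult_left z'_eq)
  moreover have "[x * z', y]\<^bsub>p * q\<^esub> = q \<star> (z * z')" "[z' * x, y]\<^bsub>p * q\<^esub> = z' * z"
    using z'_y qbracket_mult_left[of z' x y q p]
    by (simp_all add: qbracket_mult_left z_eq mult.commute[of q] flip: qbracket_eq_0_iff)
  ultimately have "q \<star> (z * z') - (t * t) \<star> (z' * z) = (q - t) \<star> (z * z' + t \<star> (z' * z))"
    by (simp add: qbracket_diff_left qbracket_scale t_square)
  then have "t \<star> (z * z') = t \<star> (q \<star> (z' * z))" by (simp add: algebra_simps)
  then have "z * z' = q \<star> (z' * z)" using t_nz by (simp only: scale_cancel_left simp_thms)
  then show ?thesis by (simp add: qcommute_def)
qed

lemma rank3_commute:
  assumes z_eq: "z = [x, y]\<^bsub>p\<^esub>" and z'_eq: "z' = [z, y]\<^bsub>t\<^esub>"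
    and z_z': "qcommute q z z'" and z'_y: "qcommute q z' y"
    and t_square: "t * t = p * q" and sum_nz: "p + t + q \<noteq> 0"
    and u_y: "qcommute 1 u y" and v_eq: "v = [u, z]\<^bsub>p\<^esub>" and v'_eq: "v' = [u, z']\<^bsub>p\<^esub>"
    and v_x: "qcommute 1 v x"
  shows "qcommute 1 v' z"
proof -
  have v'_bracket: "v' = [v, y]\<^bsub>t\<^esub>"
    unfolding v_eq v'_eq z'_eq by (rule qbracket_assoc[OF u_y])
  have v'_y: "qcommute q v' y"
    unfolding v'_eq using qcommute_qbracket_left[OF u_y z'_y] by simp
  have "[v, z]\<^bsub>t\<^esub> = [x, v']\<^bsub>p\<^esub>"
    unfolding z_eq v'_bracket by (rule qbracket_left_commute[OF v_x])
  then have "[v * z, y]\<^bsub>t * t\<^esub> - t \<star> [z * v, y]\<^bsub>t * t\<^esub> = [x * v', y]\<^bsub>p * q\<^esub> - p \<star> [v' * x, y]\<^bsub>q * p\<^esub>"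
    by (simp add: qbracket_def[of v z] qbracket_def[of x v'] t_square mult.commute[of q]
        flip: qbracket_scale qbracket_diff_left)
  then have "v * z' + t \<star> (v' * z) - t \<star> (z * v' + t \<star> (z' * v)) = q \<star> (z * v') - p \<star> (v' * z)"
    using v'_y
    by (simp add: qbracket_mult_left flip: z_eq z'_eq v'_bracket) (simp flip: qbracket_eq_0_iff)
  moreover have "v * z' + p \<star> (z * v') = q \<star> (v' * z + p \<star> (z' * v))"
    using qcommute_mixed_qbracket[OF z_z', of u p] by (simp add: v_eq v'_eq)
  moreover have "(p + t + q) \<star> (z * v' - v' * z)
    = (v * z' + p \<star> (z * v') - q \<star> (v' * z + p \<star> (z' * v)))
      - (v * z' + t \<star> (v' * z) - t \<star> (z * v' + t \<star> (z' * v)) - (q \<star> (z * v') - p \<star> (v' * z)))"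
    by (simp add: algebra_simps t_square)
  ultimately show ?thesis using sum_nz by (simp add: qcommute_1_iff)
qed

lemma rank3_qcommute:
  assumes z_eq: "z = [x, y]\<^bsub>p\<^esub>" and "qcommute q v' y" "qcommute 1 v' z" "q \<noteq> 0"
  shows "qcommute (p * q) [v', x]\<^bsub>inverse q\<^esub> y"
proof -
  have "[v' * x, y]\<^bsub>p * q\<^esub> = v' * z" "[x * v', y]\<^bsub>p * q\<^esub> = q \<star> (z * v')"
    using assms(2) qbracket_mult_left[of v' x y q p]
    by (simp_all add: qbracket_mult_left z_eq mult.commute[of q] flip: qbracket_eq_0_iff)
  then have "[[v', x]\<^bsub>inverse q\<^esub>, y]\<^bsub>p * q\<^esub> = [v', z]\<^bsub>1\<^esub>"
    using assms(4) by (simp add: qbracket_def[of v'] qbracket_diff_left qbracket_scale)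
  then show ?thesis using assms(3) by (simp flip: qbracket_eq_0_iff)
qed

text \<open>Left and right multiplication by \<open>z\<close> are commuting operators \<open>L\<close> and \<open>R\<close>, and
  \<open>sandwich z m P\<close> is the value at \<open>L\<close> and \<open>R\<close> of the homogenisation of \<open>P\<close> in degree \<open>m\<close>. For
  distinct \<open>l\<close>-th roots of unity \<open>a\<close>, \<open>L\<^sup>l - R\<^sup>l\<close> is divisible by the product of the \<open>L - a R\<close>.\<close>

definition sandwich :: "'a \<Rightarrow> nat \<Rightarrow> 'k poly \<Rightarrow> 'a \<Rightarrow> 'a" where
  "sandwich z m P y = (\<Sum>i\<le>m. coeff P i \<star> (z ^ i * y * z ^ (m - i)))"

lemma sandwich_linear_factor:
  assumes "degree P \<le> m"
  shows "sandwich z (Suc m) ([:- a, 1:] * P) y = sandwich z m P [z, y]\<^bsub>a\<^esub>"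
proof -
  have "sandwich z (Suc m) (pCons 0 P) y = sandwich z m P (z * y)"
    unfolding sandwich_def sum.atMost_Suc_shift
    by (simp add: power_Suc2 mult.assoc del: power_Suc)
  moreover have "sandwich z (Suc m) P y = sandwich z m P (y * z)"
  proof -
    have "coeff P (Suc m) = 0" using assms by (simp add: coeff_eq_0)
    moreover have "y * z ^ (Suc m - i) = y * z * z ^ (m - i)" if "i \<le> m" for i
      using that by (simp add: Suc_diff_le mult.assoc)
    ultimately show ?thesis by (simp add: sandwich_def mult.assoc)
  qed
  moreover have "sandwich z (Suc m) ([:- a, 1:] * P) y
      = sandwich z (Suc m) (pCons 0 P) y - a \<star> sandwich z (Suc m) P y"
  proof -
    have "[:- a, 1:] * P = pCons 0 P - smult a P" by simp
    then show ?thesis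
      by (simp only: sandwich_def coeff_diff coeff_smult scale_left_diff_distrib sum_subtractf
          scale_sum_right scale_scale)
  qed
  moreover have "sandwich z m P [z, y]\<^bsub>a\<^esub> = sandwich z m P (z * y) - a \<star> sandwich z m P (y * z)"
    by (simp add: sandwich_def qbracket_def scale_mult_simps sum_subtractf scale_sum_right
        mult.commute)
  ultimately show ?thesis by simp
qed

lemma sandwich_eq_0:
  assumes "distinct as" "\<And>a. a \<in> set as \<Longrightarrow> poly P a = 0" "degree P \<le> m"
    "fold (\<lambda>a y. [z, y]\<^bsub>a\<^esub>) as y = 0"
  shows "sandwich z m P y = 0"
  using assms
proof (induction as arbitrary: P m y)
  case Nil
  then show ?case by (simp add: sandwich_def)
next
  case (Cons a as)
  have "[:- a, 1:] dvd P" using Cons.prems(2) by (simp flip: poly_eq_0_iff_dvd)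
  then obtain Q where P_eq: "P = [:- a, 1:] * Q" by (rule dvdE)
  show ?case
  proof (cases "Q = 0")
    case False
    then have "degree P = Suc (degree Q)" by (simp add: P_eq degree_mult_eq del: mult_pCons_left)
    then obtain m' where m_Suc: "m = Suc m'" "degree Q \<le> m'" using Cons.prems(3) by (cases m) auto
    have "poly Q b = 0" if "b \<in> set as" for b
      using Cons.prems(1) Cons.prems(2)[of b] that by (auto simp: P_eq)
    then have "sandwich z m' Q [z, y]\<^bsub>a\<^esub> = 0"
      using Cons.prems m_Suc by (intro Cons.IH) simp_all
    then show ?thesis unfolding P_eq m_Suc(1) by (simp only: sandwich_linear_factor[OF m_Suc(2)])
  qed (simp add: P_eq sandwich_def)
qed

lemma power_commutes_if_qbracket_chain:
  assumes "distinct as" "\<And>a. a \<in> set as \<Longrightarrow> a ^ l = 1" "fold (\<lambda>a y. [z, y]\<^bsub>a\<^esub>) as y = 0"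
  shows "qcommute 1 (z ^ l) y"
proof -
  have "sandwich z l (monom 1 l - 1) y = 0"
    using assms
    by (intro sandwich_eq_0[of as]) (simp_all add: poly_monom degree_diff_le degree_monom_le)
  moreover have "sandwich z l (monom 1 l - 1) y = z ^ l * y - y * z ^ l"
    by (simp add: sandwich_def scale_left_diff_distrib sum_subtractf
        if_distrib[where f = "\<lambda>c. c \<star> _"] of_bool_def cong: if_cong)
  ultimately show ?thesis by (simp add: qcommute_1_iff)
qed

lemma power_commutes_if_chain2:
  assumes "[z, y]\<^bsub>a\<^esub> = y1" "qcommute b z y1" "a \<noteq> b" "a ^ l = 1" "b ^ l = 1"
  shows "qcommute 1 (z ^ l) y"
  using assms
  by (intro power_commutes_if_qbracket_chain[of "[a, b]"]) (auto simp: qbracket_eq_0_iff)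

lemma power_commutes_if_chain3:
  assumes "[z, y]\<^bsub>a\<^esub> = y1" "[z, y1]\<^bsub>b\<^esub> = y2" "qcommute c z y2" "distinct [a, b, c]"
    "a ^ l = 1" "b ^ l = 1" "c ^ l = 1"
  shows "qcommute 1 (z ^ l) y"
  using assms
  by (intro power_commutes_if_qbracket_chain[of "[a, b, c]"]) (auto simp: qbracket_eq_0_iff)

lemma power_commutes_if_commutator:
  assumes "[z, y]\<^bsub>1\<^esub> = c \<star> (x * v)" "qcommute a z x" "qcommute b v z"
    and "a \<noteq> b" "a ^ l = 1" "b ^ l = 1"
  shows "qcommute 1 (z ^ l) y"
proof (cases "l = 0")
  case False
  then have b_nz: "b \<noteq> 0" using assms(6) by (auto simp: power_0_left)
  then have "qcommute (a * inverse b) z (c \<star> (x * v))"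
    using assms(2,3)
    by (intro qcommute_scale_right qcommute_mult_right) (simp_all add: qcommute_inverse_iff)
  moreover have "1 \<noteq> a * inverse b" using assms(4) b_nz by (simp add: field_simps)
  ultimately show ?thesis
    using power_commutes_if_chain2[OF assms(1), of "a * inverse b" l] assms(5,6)
    by (simp add: power_mult_distrib power_inverse)
qed (simp add: qcommute_1_iff)

end

section \<open>Root vectors of the positive part\<close>

text \<open>The scalars \<open>p\<close>, \<open>q\<close>, \<open>t\<close> are \<open>r\<^sup>2\<close>, \<open>s\<^sup>2\<close> and \<open>r s\<close>.\<close>

locale type_B_positive = scalar_algebra scale
  for scale :: "'k::field \<Rightarrow> 'a::ring_1 \<Rightarrow> 'a" (infixr "\<star>" 75) +
  fixes n :: nat and p q t :: 'k and e :: "nat \<Rightarrow> 'a"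
  assumes p_nz: "p \<noteq> 0" and q_nz: "q \<noteq> 0" and t_square: "t * t = p * q"
    and p_plus_q_nz: "p + q \<noteq> 0" and p_plus_t_plus_q_nz: "p + t + q \<noteq> 0"
    and e_far: "1 \<le> i \<Longrightarrow> Suc i < j \<Longrightarrow> j \<le> n \<Longrightarrow> qcommute 1 (e i) (e j)"
    and serre_up: "1 \<le> i \<Longrightarrow> i < n \<Longrightarrow> qcommute q (e i) [e i, e (Suc i)]\<^bsub>p\<^esub>"
    and serre_down: "1 \<le> i \<Longrightarrow> Suc i < n \<Longrightarrow> qcommute q [e i, e (Suc i)]\<^bsub>p\<^esub> (e (Suc i))"
    and serre_last: "1 \<le> i \<Longrightarrow> Suc i = n \<Longrightarrow> qcommute q [[e i, e n]\<^bsub>p\<^esub>, e n]\<^bsub>t\<^esub> (e n)"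
begin

lemma t_nz: "t \<noteq> 0"
  using t_square p_nz q_nz by auto

function E :: "nat \<Rightarrow> nat \<Rightarrow> 'a" where
  "E k j = (if k < j then [e k, E (Suc k) j]\<^bsub>p\<^esub> else e j)"
  by auto
termination by (relation "measure (\<lambda>(k, j). j - k)") auto

declare E.simps [simp del]

definition bracket_scalar :: "nat \<Rightarrow> 'k" where
  "bracket_scalar j = (if j = n then t else inverse q)"

definition adjacent_scalar :: "nat \<Rightarrow> 'k" where
  "adjacent_scalar j = (if j = n then q else inverse p)"

text \<open>\<open>E' k j\<close> is \<open>E\<^sub>k\<^sub>,\<^sub>j\<^sub>'\<close>. With \<open>E' k (n + 1) = E k n\<close> one recursion covers
  the whole second half of row \<open>k\<close>.\<close>

function E' :: "nat \<Rightarrow> nat \<Rightarrow> 'a" where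
  "E' k j = (if j \<le> n then [E' k (Suc j), e j]\<^bsub>bracket_scalar j\<^esub> else E k n)"
  by auto
termination by (relation "measure (\<lambda>(k, j). Suc n - j)") auto

declare E'.simps [simp del]

lemma E_refl [simp]: "E j j = e j"
  by (subst E.simps) simp

lemma E_left: "k < j \<Longrightarrow> E k j = [e k, E (Suc k) j]\<^bsub>p\<^esub>"
  by (subst E.simps) simp

lemma E'_top [simp]: "E' k (Suc n) = E k n"
  by (subst E'.simps) simp

lemma E'_step: "j \<le> n \<Longrightarrow> E' k j = [E' k (Suc j), e j]\<^bsub>bracket_scalar j\<^esub>"
  by (subst E'.simps) simp

lemma qcommute_E_extend_left:
  assumes "qcommute c x (E m j)" "k \<le> m" "m \<le> j" "\<And>i. k \<le> i \<Longrightarrow> i < m \<Longrightarrow> qcommute 1 x (e i)"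
  shows "qcommute c x (E k j)"
  using assms(2,1,4)
proof (induction rule: inc_induct)
  case (step i)
  then show ?case using assms(3) by (simp add: E_left[of i j] qcommute_qbracket_right_1(1))
qed

lemma qcommute_E'_extend:
  assumes "qcommute c x (E' k m)" "j \<le> m" "m \<le> Suc n" "\<And>i. j \<le> i \<Longrightarrow> i < m \<Longrightarrow> qcommute 1 x (e i)"
  shows "qcommute c x (E' k j)"
  using assms(2,1,4)
proof (induction rule: inc_induct)
  case (step i)
  then show ?case using assms(3) by (simp add: E'_step[of i k] qcommute_qbracket_right_1(2))
qed

lemma qcommute_E:
  assumes "k \<le> j" "\<And>i. k \<le> i \<Longrightarrow> i \<le> j \<Longrightarrow> qcommute 1 x (e i)"
  shows "qcommute 1 x (E k j)"
  using assms by (intro qcommute_E_extend_left[of 1 x j j k]) auto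

text \<open>If the root \<open>\<alpha>\<^sub>i\<close> is written as \<open>\<epsilon>\<^sub>i - \<epsilon>\<^sub>i\<^sub>+\<^sub>1\<close> with \<open>\<epsilon>\<^sub>n\<^sub>+\<^sub>1 = 0\<close>, then \<open>E k j\<close> and \<open>E' k j\<close> have the
  weights \<open>\<epsilon>\<^sub>k - \<epsilon>\<^sub>j\<^sub>+\<^sub>1\<close> and \<open>\<epsilon>\<^sub>k + \<epsilon>\<^sub>j\<close>.\<close>

lemma qcommute_E_weight:
  assumes "\<And>i. k \<le> i \<Longrightarrow> i \<le> n \<Longrightarrow> qcommute (\<theta> i * inverse (\<theta> (Suc i))) x (e i)"
    and "\<And>i. \<theta> i \<noteq> 0" "k \<le> j" "j \<le> n"
  shows "qcommute (\<theta> k * inverse (\<theta> (Suc j))) x (E k j)"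
  using assms(3,1)
proof (induction rule: inc_induct)
  case base
  then show ?case using assms(4) by simp
next
  case (step i)
  have "qcommute (\<theta> i * inverse (\<theta> (Suc i)) * (\<theta> (Suc i) * inverse (\<theta> (Suc j)))) x (E i j)"
    using step assms(4) by (simp add: E_left qcommute_qbracket_right)
  then show ?case by (rule qcommute_cong_scalar) (simp add: assms(2))
qed

lemma qcommute_E'_weight:
  assumes weights: "\<And>i. k \<le> i \<Longrightarrow> i \<le> n \<Longrightarrow> qcommute (\<theta> i * inverse (\<theta> (Suc i))) x (e i)"
    and \<theta>_nz: "\<And>i. \<theta> i \<noteq> 0" and \<theta>_top: "\<theta> (Suc n) = 1" and "k \<le> j" "k \<le> n" "j \<le> Suc n"
  shows "qcommute (\<theta> k * \<theta> j) x (E' k j)"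
  using assms(6,4)
proof (induction rule: inc_induct)
  case base
  then show ?case using qcommute_E_weight[of k \<theta> x n] weights \<theta>_nz \<theta>_top assms(5) by simp
next
  case (step i)
  have "qcommute (\<theta> k * \<theta> (Suc i) * (\<theta> i * inverse (\<theta> (Suc i)))) x (E' k i)"
    using step weights[of i] by (simp add: E'_step qcommute_qbracket_right)
  then show ?case using \<theta>_nz[of "Suc i"] by (simp add: mult_ac)
qed

lemma e_commute:
  assumes "1 \<le> i" "i \<le> n" "1 \<le> j" "j \<le> n" "Suc i < j \<or> Suc j < i"
  shows "qcommute 1 (e i) (e j)"
  using assms e_far[of i j] qcommute_1_sym[OF e_far[of j i]] by auto

lemma e_commute_E:
  assumes "1 \<le> k" "k \<le> j" "j \<le> n" "1 \<le> i" "i \<le> n" "Suc i < k \<or> Suc j < i"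
  shows "qcommute 1 (e i) (E k j)"
  using assms by (intro qcommute_E e_commute) auto

lemma E_split:
  assumes "1 \<le> k" "k \<le> m" "m < j" "j \<le> n"
  shows "E k j = [E k m, E (Suc m) j]\<^bsub>p\<^esub>"
  using assms(2)
proof (induction rule: inc_induct)
  case base
  then show ?case using assms by (simp add: E_left)
next
  case (step i)
  have "E i j = [e i, [E (Suc i) m, E (Suc m) j]\<^bsub>p\<^esub>]\<^bsub>p\<^esub>"
    using step assms by (simp add: E_left[of i j])
  also have "\<dots> = [[e i, E (Suc i) m]\<^bsub>p\<^esub>, E (Suc m) j]\<^bsub>p\<^esub>"
    using step assms by (intro qbracket_assoc e_commute_E) auto
  finally show ?case using step by (simp add: E_left[of i m])
qed

lemma E_right: "1 \<le> k \<Longrightarrow> k \<le> j \<Longrightarrow> j < n \<Longrightarrow> E k (Suc j) = [E k j, e (Suc j)]\<^bsub>p\<^esub>"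
  using E_split[of k j "Suc j"] by simp

lemma qcommute_E_extend_right:
  assumes "qcommute c x (E k m)" "1 \<le> k" "k \<le> m" "m \<le> j" "j \<le> n"
    and "\<And>i. m < i \<Longrightarrow> i \<le> j \<Longrightarrow> qcommute 1 x (e i)"
  shows "qcommute c x (E k j)"
proof (cases "m < j")
  case True
  then show ?thesis
    using assms by (simp add: E_split[of k m j] qcommute_qbracket_right_1(2) qcommute_E)
qed (use assms in simp)

lemma E'_left:
  assumes "1 \<le> k" "Suc k < j" "j \<le> Suc n"
  shows "E' k j = [e k, E' (Suc k) j]\<^bsub>p\<^esub>"
  using assms(3)
proof (induction rule: inc_induct)
  case base
  then show ?case using assms by (simp add: E_left)
next
  case (step i)
  have "E' k i = [[e k, E' (Suc k) (Suc i)]\<^bsub>p\<^esub>, e i]\<^bsub>bracket_scalar i\<^esub>"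
    using step by (simp add: E'_step)
  also have "\<dots> = [e k, [E' (Suc k) (Suc i), e i]\<^bsub>bracket_scalar i\<^esub>]\<^bsub>p\<^esub>"
    using step assms by (intro qbracket_assoc[symmetric] e_commute) auto
  finally show ?case using step by (simp add: E'_step)
qed

lemma qcommute_E'_extend_left:
  assumes "qcommute c x (E' m j)" "1 \<le> k" "k \<le> m" "m < j" "j \<le> Suc n"
    and "\<And>i. k \<le> i \<Longrightarrow> i < m \<Longrightarrow> qcommute 1 x (e i)"
  shows "qcommute c x (E' k j)"
  using assms(3,1,6)
proof (induction rule: inc_induct)
  case (step i)
  then show ?case using assms(2,4,5) by (simp add: E'_left[of i j] qcommute_qbracket_right_1(1))
qed

lemma E_first:
  assumes "1 \<le> k" "k < j" "j \<le> n"
  shows "qcommute q (e k) (E k j)"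
proof (rule qcommute_E_extend_right[of q _ k "Suc k"])
  show "qcommute q (e k) (E k (Suc k))" using serre_up[of k] assms by (simp add: E_left)
qed (use assms in \<open>auto intro: e_commute\<close>)

lemma E_last:
  assumes "1 \<le> k" "k < j" "j < n"
  shows "qcommute q (E k j) (e j)"
proof -
  obtain m where j_Suc: "j = Suc m" using assms by (cases j) auto
  have "qcommute (inverse q) (e j) (E m j)"
    using serre_down[of m] q_nz assms by (simp add: j_Suc E_left qcommute_inverse_iff)
  then have "qcommute (inverse q) (e j) (E k j)"
    by (rule qcommute_E_extend_left) (use assms in \<open>auto simp: j_Suc intro: e_commute\<close>)
  then show ?thesis using q_nz by (simp add: qcommute_inverse_iff)
qed

lemma e_commute_E_middle:
  assumes "1 \<le> k" "k < i" "i < j" "j \<le> n"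
  shows "qcommute 1 (e i) (E k j)"
proof -
  obtain m where i_Suc: "i = Suc m" using assms by (cases i) auto
  have "qcommute 1 (e i) [[e m, e i]\<^bsub>p\<^esub>, e (Suc i)]\<^bsub>p\<^esub>"
    using e_far[of m "Suc i"] serre_down[of m] serre_up[of i] p_plus_q_nz assms
    by (intro qbracket_middle_commutes[where q = q]) (auto simp: i_Suc)
  then have "qcommute 1 (e i) (E m (Suc i))"
    using assms i_Suc by (simp add: E_right[of m "Suc m"] E_left[of m "Suc m"])
  then have "qcommute 1 (e i) (E m j)"
    by (rule qcommute_E_extend_right) (use assms i_Suc in \<open>auto intro: e_commute\<close>)
  then show ?thesis
    by (rule qcommute_E_extend_left) (use assms i_Suc in \<open>auto intro: e_commute\<close>)
qed

lemma e_commute_E':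
  assumes "1 \<le> k" "k < i" "Suc i < j" "j \<le> Suc n"
  shows "qcommute 1 (e i) (E' k j)"
proof (rule qcommute_E'_extend)
  show "qcommute 1 (e i) (E' k (Suc n))" using assms by (simp add: e_commute_E_middle)
qed (use assms in \<open>auto intro: e_commute\<close>)

lemma E'_last:
  assumes "1 \<le> k" "k < j" "j \<le> n"
  shows "qcommute (adjacent_scalar j) (E' k j) (e j)"
proof (cases "j = n")
  case True
  obtain m where m_Suc: "Suc m = n" "1 \<le> m" "k \<le> m" using assms True by (cases n) auto
  have "qcommute (inverse q) (e n) (E' m n)"
    using serre_last[of m] m_Suc q_nz
    by (simp add: E'_step[of n] E_left[of m n] bracket_scalar_def qcommute_inverse_iff)
  then have "qcommute (inverse q) (e n) (E' k n)"
    by (rule qcommute_E'_extend_left) (use assms True m_Suc in \<open>simp_all add: e_commute\<close>)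
  then show ?thesis using q_nz True by (simp add: adjacent_scalar_def qcommute_inverse_iff)
next
  case False
  define u where "u = E' k (Suc (Suc j))"
  have u_commute: "qcommute 1 (e j) u"
    unfolding u_def using assms False by (intro e_commute_E') auto
  have E'_eq: "E' k (Suc j) = [u, e (Suc j)]\<^bsub>bracket_scalar (Suc j)\<^esub>"
    "E' k j = [E' k (Suc j), e j]\<^bsub>inverse q\<^esub>"
    using assms False by (simp_all add: u_def E'_step bracket_scalar_def)
  have "qcommute p (e j) [e j, e (Suc j)]\<^bsub>q\<^esub>"
    using qcommute_exchange_scalars(1)[OF serre_up[of j]] assms False by simp
  then have "qcommute p (e j) [e j, E' k (Suc j)]\<^bsub>q\<^esub>"
    using u_commute
    by (simp add: E'_eq(1) qbracket_left_commute[OF u_commute] qcommute_qbracket_right_1(1))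
  then have "qcommute p (e j) (E' k j)"
    using q_nz
    by (simp add: E'_eq(2) qbracket_swap[of "inverse q" q "E' k (Suc j)"] qcommute_scale_right
      qcommute_minus_right)
  then show ?thesis
    using p_nz False by (simp add: adjacent_scalar_def qcommute_inverse_iff)
qed

lemma adjacent_E:
  assumes "1 \<le> k" "k \<le> j" "j < n"
  shows "qcommute q (E k j) (E k (Suc j))"
  using assms(2,3)
proof (induction rule: dec_induct)
  case base
  then show ?case using E_first[of k "Suc k"] assms by simp
next
  case (step m)
  have "qcommute q (E k m) (E k (Suc (Suc m)))"
    using step assms qcommute_1_sym[OF e_commute_E[of k m "Suc (Suc m)"]]
    by (simp add: E_right[of k "Suc m"] qcommute_qbracket_right_1(2))
  moreover have "qcommute 1 (e (Suc m)) (E k (Suc (Suc m)))"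
    using step assms by (intro e_commute_E_middle) auto
  ultimately have "qcommute (q * 1) [E k m, e (Suc m)]\<^bsub>p\<^esub> (E k (Suc (Suc m)))"
    by (rule qcommute_qbracket_left)
  then show ?case using step assms by (simp add: E_right[of k m])
qed

lemma adjacent_E'_n:
  assumes "1 \<le> k" "k < n"
  shows "qcommute q (E k n) (E' k n)"
proof -
  obtain m where n_Suc: "Suc m = n" "k \<le> m" using assms by (cases n) auto
  from n_Suc(2) show ?thesis
  proof (induction rule: inc_induct)
    case base
    have "qcommute q (e m) (E m n)" "qcommute q (E' m n) (e n)"
      using E_first[of m n] E'_last[of m n] assms n_Suc by (simp_all add: adjacent_scalar_def)
    moreover have "E m n = [e m, e n]\<^bsub>p\<^esub>" "E' m n = [E m n, e n]\<^bsub>t\<^esub>"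
      using n_Suc(1) by (simp_all add: E_left E'_step bracket_scalar_def)
    ultimately show ?case using rank2_qcommute t_square t_nz by blast
  next
    case (step i)
    have "qcommute q (e i) (E i n)" using E_first[of i n] step assms n_Suc by simp
    moreover from this have "qcommute q (e i) (E' i n)"
      using e_commute[of i n] step assms n_Suc by (simp add: E'_step qcommute_qbracket_right_1(2))
    moreover have "E i n = [e i, E (Suc i) n]\<^bsub>p\<^esub>" "E' i n = [e i, E' (Suc i) n]\<^bsub>p\<^esub>"
      using step assms n_Suc by (simp_all add: E_left E'_left)
    ultimately show ?case
      using qcommute_lift_left[OF step.IH, of q "e i" p] p_plus_q_nz by simp
  qed
qed

lemma E'_n_commute_E:
  assumes "1 \<le> k" "k < m" "m < n"
  shows "qcommute 1 (E' k n) (E m n)"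
proof -
  define i where "i = n - 2"
  have n_bounds: "Suc (Suc i) = n" "k \<le> i" "i < n" "Suc i < n" "m \<le> Suc i"
    using assms by (auto simp: i_def)
  have "qcommute 1 (E' k n) (E (Suc i) n)"
  proof (rule rank3_commute)
    show "E (Suc i) n = [e (Suc i), e n]\<^bsub>p\<^esub>" "E' (Suc i) n = [E (Suc i) n, e n]\<^bsub>t\<^esub>"
      using n_bounds by (simp_all add: E_left E'_step bracket_scalar_def)
    show "qcommute q (E (Suc i) n) (E' (Suc i) n)" "qcommute q (E' (Suc i) n) (e n)"
      using adjacent_E'_n[of "Suc i"] E'_last[of "Suc i" n] n_bounds
      by (simp_all add: adjacent_scalar_def)
    show E_e_commute: "qcommute 1 (E k i) (e n)"
      using assms n_bounds by (intro qcommute_1_sym[OF e_commute_E]) auto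
    show E_eq: "E k n = [E k i, E (Suc i) n]\<^bsub>p\<^esub>"
      using assms n_bounds by (intro E_split) auto
    show "E' k n = [E k i, E' (Suc i) n]\<^bsub>p\<^esub>"
      using qbracket_assoc[OF E_e_commute] E_eq by (simp add: E'_step)
    show "qcommute 1 (E k n) (e (Suc i))"
      using assms n_bounds by (intro qcommute_1_sym[OF e_commute_E_middle]) auto
  qed (fact t_square p_plus_t_plus_q_nz)+
  then show ?thesis
    by (rule qcommute_E_extend_left)
      (use assms n_bounds(3-) in \<open>auto intro: qcommute_1_sym[OF e_commute_E']\<close>)
qed

lemma E'_after_n:
  assumes "1 \<le> k" "k < j" "j < n"
  shows "qcommute (p * q) (E' k j) (e n)"
proof -
  obtain m where n_Suc: "Suc m = n" "j \<le> m" "m < n" using assms by (cases n) auto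
  have "qcommute (p * q) [E' k n, e m]\<^bsub>inverse q\<^esub> (e n)"
    using E'_last[of k n] E'_n_commute_E[of k m] q_nz assms n_Suc
    by (intro rank3_qcommute[of "E m n" "e m" "e n"])
      (simp_all add: E_left[of m n] adjacent_scalar_def)
  then have "qcommute (inverse (p * q)) (e n) (E' k m)"
    using n_Suc p_nz q_nz
    by (simp add: E'_step[of m] bracket_scalar_def qcommute_inverse_iff del: inverse_mult_distrib)
  then have "qcommute (inverse (p * q)) (e n) (E' k j)"
    by (rule qcommute_E'_extend) (use assms n_Suc in \<open>auto intro: e_commute\<close>)
  then show ?thesis
    using p_nz q_nz by (simp add: qcommute_inverse_iff del: inverse_mult_distrib)
qed

lemma E'_after:
  assumes "1 \<le> k" "k < j" "j < i" "i < n"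
  shows "qcommute 1 (e i) (E' k j)"
proof -
  obtain m where i_Suc: "i = Suc m" using assms by (cases i) auto
  have "qcommute 1 (e i) [[E' k (Suc i), e i]\<^bsub>inverse q\<^esub>, e m]\<^bsub>inverse q\<^esub>"
  proof (rule qbracket_middle_commutes)
    show "qcommute 1 (E' k (Suc i)) (e m)"
      using assms i_Suc by (intro qcommute_1_sym[OF e_commute_E']) auto
    show "qcommute (inverse p) [E' k (Suc i), e i]\<^bsub>inverse q\<^esub> (e i)"
      using E'_last[of k i] assms by (simp add: E'_step bracket_scalar_def adjacent_scalar_def)
    have "qcommute p [e m, e i]\<^bsub>q\<^esub> (e i)"
      using qcommute_exchange_scalars(2)[OF serre_down[of m]] assms i_Suc by simp
    then have "qcommute (inverse p) (e i) [e m, e i]\<^bsub>q\<^esub>"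
      using p_nz by (simp add: qcommute_inverse_iff)
    then show "qcommute (inverse p) (e i) [e i, e m]\<^bsub>inverse q\<^esub>"
      using q_nz
      by (simp add: qbracket_swap[of "inverse q" q] qcommute_scale_right qcommute_minus_right)
    show "inverse q + inverse p \<noteq> 0"
      using p_nz q_nz p_plus_q_nz by (simp add: field_simps)
  qed
  then have "qcommute 1 (e i) (E' k m)"
    using assms i_Suc by (simp add: E'_step[of m k] E'_step[of "Suc m" k] bracket_scalar_def)
  then show ?thesis
    by (rule qcommute_E'_extend) (use assms i_Suc in \<open>auto intro: e_commute\<close>)
qed

definition E'_weight :: "nat \<Rightarrow> nat \<Rightarrow> 'k" where
  "E'_weight j m = (if m = j then q else if m \<le> n then p * q else 1)"

lemma E'_weight_e:
  assumes "1 \<le> k" "k < j" "j \<le> m" "m \<le> n"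
  shows "qcommute (E'_weight j m * inverse (E'_weight j (Suc m))) (E' k j) (e m)"
proof -
  consider (same) "m = j" | (between) "j < m" "m < n" | (last) "j < m" "m = n"
    using assms by linarith
  then show ?thesis
  proof cases
    case same
    have "adjacent_scalar j = E'_weight j j * inverse (E'_weight j (Suc j))"
      using assms(3,4) p_nz q_nz unfolding adjacent_scalar_def E'_weight_def by auto
    then show ?thesis using E'_last[of k j] assms same by simp
  next
    case between
    then show ?thesis
      using qcommute_1_sym[OF E'_after[of k j m]] assms p_nz q_nz
      by (simp add: E'_weight_def field_simps)
  next
    case last
    then show ?thesis using E'_after_n[of k j] assms by (simp add: E'_weight_def)
  qed
qed

lemma E'_weight_nz: "E'_weight j m \<noteq> 0"
  using p_nz q_nz by (simp add: E'_weight_def)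

lemma E'_qcommute_E:
  assumes "1 \<le> k" "k < j" "j \<le> i" "i \<le> n"
  shows "qcommute (if i = n then q else inverse p) (E' k j) (E j i)"
proof -
  have "qcommute (E'_weight j j * inverse (E'_weight j (Suc i))) (E' k j) (E j i)"
    using qcommute_E_weight[of j "E'_weight j" "E' k j" i] E'_weight_e E'_weight_nz assms by blast
  then show ?thesis
    by (rule qcommute_cong_scalar) (use assms p_nz q_nz in \<open>auto simp: E'_weight_def\<close>)
qed

lemma E'_qcommute_E':
  assumes "1 \<le> k" "k < j" "j < i" "i \<le> n"
  shows "qcommute (q * (p * q)) (E' k j) (E' j i)"
proof -
  have "qcommute (E'_weight j j * E'_weight j i) (E' k j) (E' j i)"
    using qcommute_E'_weight[of j "E'_weight j" "E' k j" i] E'_weight_e E'_weight_nz assms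
    by (simp add: E'_weight_def)
  then show ?thesis using assms by (simp add: E'_weight_def)
qed

lemma adjacent_E':
  assumes "1 \<le> k" "k < j" "j \<le> n"
  shows "qcommute (adjacent_scalar j) (E' k (Suc j)) (E' k j)"
  using assms(3,2)
proof (induction rule: inc_induct)
  case base
  then show ?case using adjacent_E'_n[of k] assms by (simp add: adjacent_scalar_def)
next
  case (step i)
  have "qcommute (adjacent_scalar (Suc i)) (E' k (Suc (Suc i))) (E' k i)"
    using step assms qcommute_1_sym[OF e_commute_E'[of k i "Suc (Suc i)"]]
    by (simp add: E'_step[of i k] qcommute_qbracket_right_1(2))
  moreover have "qcommute (if Suc i = n then inverse (p * q) else 1) (e (Suc i)) (E' k i)"
  proof (cases "Suc i = n")
    case True
    have "qcommute (inverse (p * q)) (e n) (E' k i)"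
      using E'_after_n[of k i] step assms p_nz q_nz
      by (simp add: qcommute_inverse_iff del: inverse_mult_distrib)
    then show ?thesis using True by simp
  next
    case False
    then have "qcommute 1 (e (Suc i)) (E' k i)"
      using step(1,2,4) assms by (intro E'_after) auto
    then show ?thesis using False by simp
  qed
  ultimately have "qcommute (adjacent_scalar (Suc i) * (if Suc i = n then inverse (p * q) else 1))
      [E' k (Suc (Suc i)), e (Suc i)]\<^bsub>bracket_scalar (Suc i)\<^esub> (E' k i)"
    by (rule qcommute_qbracket_left)
  moreover have
    "adjacent_scalar (Suc i) * (if Suc i = n then inverse (p * q) else 1) = adjacent_scalar i"
    using step(2) q_nz by (simp add: adjacent_scalar_def)
  moreover have "[E' k (Suc (Suc i)), e (Suc i)]\<^bsub>bracket_scalar (Suc i)\<^esub> = E' k (Suc i)"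
    using step(2) by (simp add: E'_step[of "Suc i"])
  ultimately show ?case by simp
qed

lemma E_qcommute_E_next_row:
  assumes "1 \<le> k" "k < j" "j < n"
  shows "qcommute q (E k j) (E (Suc k) j)"
proof (rule qcommute_E_extend_left)
  show "qcommute q (E k j) (E j j)" using assms by (simp add: E_last)
qed (use assms in \<open>auto intro: qcommute_1_sym[OF e_commute_E_middle]\<close>)

lemma E'_qcommute_E'_next_row:
  assumes "1 \<le> k" "Suc k < j" "j \<le> n"
  shows "qcommute q (E' k j) (E' (Suc k) j)"
  using assms(3,2)
proof (induction rule: inc_induct)
  case base
  have "qcommute (1 * q) (E' k n) [E (Suc k) n, e n]\<^bsub>t\<^esub>"
    using E'_n_commute_E[of k "Suc k"] E'_last[of k n] assms base
    by (intro qcommute_qbracket_right) (simp_all add: adjacent_scalar_def)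
  then show ?case by (simp add: E'_step bracket_scalar_def)
next
  case (step i)
  have E'_eq: "E' m i = [E' m (Suc i), e i]\<^bsub>inverse q\<^esub>" for m
    using step by (simp add: E'_step bracket_scalar_def)
  have E'_e: "qcommute (inverse p) (E' m i) (e i)" if "m = k \<or> m = Suc k" for m
    using E'_last[of m i] that step assms by (auto simp: adjacent_scalar_def)
  have "inverse q + inverse p \<noteq> 0"
    using p_nz q_nz p_plus_q_nz by (simp add: field_simps)
  then show ?case
    using step E'_e
      qcommute_lift_right[of q "E' k (Suc i)" "E' (Suc k) (Suc i)" "inverse p" "e i" "inverse q"]
    by (simp flip: E'_eq)
qed

lemma E_n_qcommute_qbracket_E_next_row:
  assumes "1 \<le> k" "k < n"
  shows "qcommute q (E k n) [E k n, E (Suc k) n]\<^bsub>t\<^esub>"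
proof -
  have "Suc k \<le> n" using assms by simp
  then show ?thesis
  proof (induction rule: inc_induct)
    case base
    then show ?case using adjacent_E'_n[of k] assms by (simp add: E'_step bracket_scalar_def)
  next
    case (step i)
    have E_e_commute: "qcommute 1 (E k n) (e i)"
      using step assms by (intro qcommute_1_sym[OF e_commute_E_middle]) auto
    have "[E k n, E i n]\<^bsub>t\<^esub> = [e i, [E k n, E (Suc i) n]\<^bsub>t\<^esub>]\<^bsub>p\<^esub>"
      using step by (simp add: E_left[of i n] qbracket_left_commute[OF E_e_commute])
    then show ?case using step E_e_commute by (simp add: qcommute_qbracket_right_1(1))
  qed
qed

end

section \<open>Torus weights and commutators with the \<open>f\<^sub>i\<close>\<close>

text \<open>The scalar by which \<open>\<omega>\<^sub>i\<close> \<open>q\<close>-commutes with vectors of weight \<open>\<epsilon>\<^sub>m\<close>; for \<open>\<omega>\<^sub>i'\<close> the scalars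
  \<open>p\<close> and \<open>q\<close> are exchanged.\<close>

definition eps_scalar :: "nat \<Rightarrow> 'k::field \<Rightarrow> 'k \<Rightarrow> 'k \<Rightarrow> nat \<Rightarrow> nat \<Rightarrow> 'k" where
  "eps_scalar n p q t i m =
     (if i = n then (if m < n then inverse t else if m = n then p * inverse t else 1)
      else if m = i then p
      else if m = Suc i then q
      else 1)"

locale type_B_quantum_group = type_B_positive scale n p q t e
  for scale :: "'k::field \<Rightarrow> 'a::ring_1 \<Rightarrow> 'a" (infixr "\<star>" 75) and n p q t e +
  fixes f w w' :: "nat \<Rightarrow> 'a" and \<eta> :: "nat \<Rightarrow> 'k"
  assumes p_ne_q: "p \<noteq> q" and \<eta>_nz: "1 \<le> i \<Longrightarrow> i \<le> n \<Longrightarrow> \<eta> i \<noteq> 0"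
    and w'_invertible: "1 \<le> i \<Longrightarrow> i \<le> n \<Longrightarrow> \<exists>v. w' i * v = 1"
    and w_w: "1 \<le> i \<Longrightarrow> i \<le> n \<Longrightarrow> 1 \<le> j \<Longrightarrow> j \<le> n \<Longrightarrow> qcommute 1 (w i) (w j)"
    and w_w': "1 \<le> i \<Longrightarrow> i \<le> n \<Longrightarrow> 1 \<le> j \<Longrightarrow> j \<le> n \<Longrightarrow> qcommute 1 (w i) (w' j)"
    and w'_w': "1 \<le> i \<Longrightarrow> i \<le> n \<Longrightarrow> 1 \<le> j \<Longrightarrow> j \<le> n \<Longrightarrow> qcommute 1 (w' i) (w' j)"
    and w_e: "1 \<le> i \<Longrightarrow> i \<le> n \<Longrightarrow> 1 \<le> j \<Longrightarrow> j \<le> n \<Longrightarrow>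
      qcommute (eps_scalar n p q t i j * inverse (eps_scalar n p q t i (Suc j))) (w i) (e j)"
    and w'_e: "1 \<le> i \<Longrightarrow> i \<le> n \<Longrightarrow> 1 \<le> j \<Longrightarrow> j \<le> n \<Longrightarrow>
      qcommute (eps_scalar n q p t i j * inverse (eps_scalar n q p t i (Suc j))) (w' i) (e j)"
    and w_f: "1 \<le> i \<Longrightarrow> i \<le> n \<Longrightarrow> 1 \<le> j \<Longrightarrow> j \<le> n \<Longrightarrow>
      qcommute (eps_scalar n p q t i (Suc j) * inverse (eps_scalar n p q t i j)) (w i) (f j)"
    and w'_f: "1 \<le> i \<Longrightarrow> i \<le> n \<Longrightarrow> 1 \<le> j \<Longrightarrow> j \<le> n \<Longrightarrow>
      qcommute (eps_scalar n q p t i (Suc j) * inverse (eps_scalar n q p t i j)) (w' i) (f j)"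
    and e_f: "1 \<le> i \<Longrightarrow> i \<le> n \<Longrightarrow> 1 \<le> j \<Longrightarrow> j \<le> n \<Longrightarrow>
      [e i, f j]\<^bsub>1\<^esub> = (if i = j then \<eta> i \<star> (w i - w' i) else 0)"
begin

abbreviation wt :: "nat \<Rightarrow> nat \<Rightarrow> 'k" where "wt \<equiv> eps_scalar n p q t"
abbreviation wt' :: "nat \<Rightarrow> nat \<Rightarrow> 'k" where "wt' \<equiv> eps_scalar n q p t"

lemmas wt_simps = eps_scalar_def p_nz q_nz t_nz

lemma wt_nz: "wt i m \<noteq> 0" "wt' i m \<noteq> 0"
  by (simp_all add: wt_simps)

lemma w_E:
  assumes "1 \<le> i" "i \<le> n" "1 \<le> k" "k \<le> j" "j \<le> n"
  shows "qcommute (wt i k * inverse (wt i (Suc j))) (w i) (E k j)"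
    and "qcommute (wt' i k * inverse (wt' i (Suc j))) (w' i) (E k j)"
  using qcommute_E_weight[of k "wt i" "w i" j] qcommute_E_weight[of k "wt' i" "w' i" j]
    w_e w'_e wt_nz assms by simp_all

lemma w_E':
  assumes "1 \<le> i" "i \<le> n" "1 \<le> k" "k < j" "j \<le> Suc n"
  shows "qcommute (wt i k * wt i j) (w i) (E' k j)"
    and "qcommute (wt' i k * wt' i j) (w' i) (E' k j)"
proof -
  have "wt i (Suc n) = 1" "wt' i (Suc n) = 1" using assms(2) by (simp_all add: wt_simps)
  then show "qcommute (wt i k * wt i j) (w i) (E' k j)"
    "qcommute (wt' i k * wt' i j) (w' i) (E' k j)"
    using qcommute_E'_weight[of k "wt i" "w i" j] qcommute_E'_weight[of k "wt' i" "w' i" j]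
      w_e w'_e wt_nz assms by simp_all
qed

lemma e_f_commute: "1 \<le> i \<Longrightarrow> i \<le> n \<Longrightarrow> 1 \<le> j \<Longrightarrow> j \<le> n \<Longrightarrow> i \<noteq> j \<Longrightarrow> qcommute 1 (f j) (e i)"
  using qcommute_1_sym[of "e i" "f j"] by (simp add: e_f flip: qbracket_eq_0_iff)

lemma E_f_outside:
  assumes "1 \<le> k" "k \<le> j" "j \<le> n" "1 \<le> i" "i \<le> n" "i < k \<or> j < i"
  shows "qcommute 1 (E k j) (f i)"
  using assms by (intro qcommute_1_sym[OF qcommute_E]) (auto intro: e_f_commute)

lemma E_f_last:
  assumes "1 \<le> k" "k \<le> j" "j < n"
  shows "[E k (Suc j), f (Suc j)]\<^bsub>1\<^esub> = (\<eta> (Suc j) * (p * inverse q - 1)) \<star> (E k j * w' (Suc j))"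
proof -
  have "wt (Suc j) k * inverse (wt (Suc j) (Suc j)) = inverse p"
    "wt' (Suc j) k * inverse (wt' (Suc j) (Suc j)) = inverse q"
    using assms by (simp_all add: wt_simps)
  then have "qcommute (inverse p) (w (Suc j)) (E k j)" "qcommute (inverse q) (w' (Suc j)) (E k j)"
    using w_E[of "Suc j" k j] assms by simp_all
  then have "[E k j, \<eta> (Suc j) \<star> (w (Suc j) - w' (Suc j))]\<^bsub>p\<^esub>
      = (\<eta> (Suc j) * (p * inverse q - 1)) \<star> (E k j * w' (Suc j))"
    using p_nz by (simp add: qbracket_scaled_diff)
  moreover have "[E k j, f (Suc j)]\<^bsub>1\<^esub> = 0"
    using E_f_outside[of k j "Suc j"] assms by (simp add: qbracket_eq_0_iff)
  ultimately show ?thesis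
    using assms by (simp add: E_right qbracket_qbracket_derivation e_f)
qed

lemma E_f_middle:
  assumes "1 \<le> k" "k < i" "i < j" "j \<le> n"
  shows "qcommute 1 (E k j) (f i)"
proof -
  obtain m where i_Suc: "i = Suc m" using assms by (cases i) auto
  have "qcommute (1 * p) (E k m * w' i) (e (Suc i))"
    using qcommute_1_sym[OF e_commute_E[of k m "Suc i"]] w'_e[of i "Suc i"] assms i_Suc
    by (intro qcommute_mult_left) (auto simp: wt_simps)
  then have "[[E k i, f i]\<^bsub>1\<^esub>, e (Suc i)]\<^bsub>p\<^esub> = 0"
    using E_f_last[of k m] assms i_Suc by (simp add: qbracket_scale qbracket_eq_0_iff)
  then have "[E k (Suc i), f i]\<^bsub>1\<^esub> = 0"
    using assms by (simp add: E_right[of k i] qbracket_qbracket_derivation e_f)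
  then have "qcommute 1 (f i) (E k (Suc i))"
    by (simp add: qcommute_1_sym qbracket_eq_0_iff)
  then have "qcommute 1 (f i) (E k j)"
    by (rule qcommute_E_extend_right) (use assms in \<open>auto intro: e_f_commute\<close>)
  then show ?thesis by (rule qcommute_1_sym)
qed

lemma E_f_first:
  assumes "1 \<le> k" "k < j" "j \<le> n"
  shows "[E k j, f k]\<^bsub>1\<^esub> = (\<eta> k * (q - p)) \<star> (E (Suc k) j * w k)"
proof -
  have "qcommute q (w k) (E (Suc k) j)" "qcommute p (w' k) (E (Suc k) j)"
    using w_E[of k "Suc k" j] assms by (simp_all add: wt_simps)
  then have "[\<eta> k \<star> (w k - w' k), E (Suc k) j]\<^bsub>p\<^esub> = (\<eta> k * (q - p)) \<star> (E (Suc k) j * w k)"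
    by (simp add: qbracket_scaled_diff)
  moreover have "[E (Suc k) j, f k]\<^bsub>1\<^esub> = 0"
    using E_f_outside[of "Suc k" j k] assms by (simp add: qbracket_eq_0_iff)
  ultimately show ?thesis
    using assms by (simp add: E_left qbracket_qbracket_derivation e_f)
qed

lemma E'_f_before:
  assumes "1 \<le> k" "k < i" "i < j" "i < n" "j \<le> Suc n"
  shows "qcommute 1 (E' k j) (f i)"
proof -
  have "qcommute 1 (f i) (E' k (Suc n))"
    using E_f_middle[of k i n] assms by (simp add: qcommute_1_sym)
  then have "qcommute 1 (f i) (E' k j)"
    by (rule qcommute_E'_extend) (use assms in \<open>auto intro: e_f_commute\<close>)
  then show ?thesis by (rule qcommute_1_sym)
qed

lemma E'_f_last_n:
  assumes "1 \<le> k" "k < n"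
  shows "[E' k n, f n]\<^bsub>1\<^esub> = (\<eta> n * (p * inverse q - 1) * (q * inverse t)) \<star> (E k n * w' n)"
proof -
  obtain m where n_Suc: "Suc m = n" "k \<le> m" "m < n" using assms by (cases n) auto
  have "[E k m * w' n, e n]\<^bsub>p * (q * inverse t)\<^esub> = (q * inverse t) \<star> (E k n * w' n)"
  proof -
    have "qcommute (q * inverse t) (w' n) (e n)" using w'_e[of n n] assms by (simp add: wt_simps)
    then show ?thesis
      using E_right[of k m] assms n_Suc
      unfolding qbracket_mult_left by (simp flip: qbracket_eq_0_iff)
  qed
  moreover have "p * (q * inverse t) = t" using t_square t_nz by (simp add: field_simps)
  moreover have "[E k n, f n]\<^bsub>1\<^esub> = (\<eta> n * (p * inverse q - 1)) \<star> (E k m * w' n)"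
    using E_f_last[of k m] assms n_Suc by simp
  ultimately have
    "[[E k n, f n]\<^bsub>1\<^esub>, e n]\<^bsub>t\<^esub> = (\<eta> n * (p * inverse q - 1) * (q * inverse t)) \<star> (E k n * w' n)"
    by (simp add: qbracket_scale mult.assoc)
  moreover have "[E k n, [e n, f n]\<^bsub>1\<^esub>]\<^bsub>t\<^esub> = 0"
  proof -
    have "qcommute (inverse t) (w n) (E k n)" "qcommute (inverse t) (w' n) (E k n)"
      using w_E[of n k n] assms by (simp_all add: wt_simps)
    then show ?thesis using t_nz assms by (simp add: e_f qbracket_scaled_diff)
  qed
  ultimately show ?thesis
    by (simp add: E'_step bracket_scalar_def qbracket_qbracket_derivation)
qed

lemma E'_f_last:
  assumes "1 \<le> k" "k < j" "j \<le> n"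
  shows "\<exists>c. c \<noteq> 0 \<and> [E' k j, f j]\<^bsub>1\<^esub> = c \<star> (E' k (Suc j) * w' j)"
proof (cases "j = n")
  case True
  define c where "c = \<eta> n * (p * inverse q - 1) * (q * inverse t)"
  have "c \<noteq> 0"
    using \<eta>_nz[of n] p_ne_q q_nz t_nz assms by (simp add: c_def field_simps)
  moreover have "[E' k j, f j]\<^bsub>1\<^esub> = c \<star> (E' k (Suc j) * w' j)"
    using E'_f_last_n[of k] assms True by (simp add: c_def)
  ultimately show ?thesis by blast
next
  case False
  have "qcommute q (w j) (E' k (Suc j))" "qcommute p (w' j) (E' k (Suc j))"
    using w_E'[of j k "Suc j"] assms False by (simp_all add: wt_simps)
  then have "[E' k (Suc j), \<eta> j \<star> (w j - w' j)]\<^bsub>inverse q\<^esub> = (\<eta> j * (p * inverse q - 1)) \<star> (E' k (Suc j) * w' j)"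
    using q_nz by (simp add: qbracket_scaled_diff mult.commute[of p])
  moreover have "[E' k (Suc j), f j]\<^bsub>1\<^esub> = 0"
    using E'_f_before[of k j "Suc j"] assms False by (simp add: qbracket_eq_0_iff)
  ultimately have "[E' k j, f j]\<^bsub>1\<^esub> = (\<eta> j * (p * inverse q - 1)) \<star> (E' k (Suc j) * w' j)"
    using assms False
    by (simp add: E'_step[of j] bracket_scalar_def qbracket_qbracket_derivation e_f)
  moreover have "\<eta> j * (p * inverse q - 1) \<noteq> 0"
    using \<eta>_nz[of j] p_ne_q q_nz assms by (simp add: field_simps)
  ultimately show ?thesis by blast
qed

lemma E'_f_after:
  assumes "1 \<le> k" "k < j" "j < i" "i \<le> n"
  shows "qcommute 1 (E' k j) (f i)"
proof -
  obtain m where i_Suc: "i = Suc m" using assms by (cases i) auto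
  obtain c where commutator: "[E' k i, f i]\<^bsub>1\<^esub> = c \<star> (E' k (Suc i) * w' i)"
    using E'_f_last[of k i] assms by auto
  have "wt' i m * inverse (wt' i (Suc m)) = inverse q"
    using assms i_Suc by (simp add: wt_simps)
  then have "qcommute (1 * inverse q) (E' k (Suc i) * w' i) (e m)"
    using qcommute_1_sym[OF e_commute_E'[of k m "Suc i"]] w'_e[of i m] assms i_Suc
    by (intro qcommute_mult_left) auto
  then have "[[E' k i, f i]\<^bsub>1\<^esub>, e m]\<^bsub>inverse q\<^esub> = 0"
    by (simp add: commutator qbracket_scale qbracket_eq_0_iff)
  then have "[E' k m, f i]\<^bsub>1\<^esub> = 0"
    using assms i_Suc
    by (simp add: E'_step[of m] bracket_scalar_def qbracket_qbracket_derivation e_f)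
  then have "qcommute 1 (f i) (E' k m)"
    by (simp add: qcommute_1_sym qbracket_eq_0_iff)
  then have "qcommute 1 (f i) (E' k j)"
    by (rule qcommute_E'_extend) (use assms i_Suc in \<open>auto intro: e_f_commute\<close>)
  then show ?thesis by (rule qcommute_1_sym)
qed

lemma E'_f_other:
  assumes "1 \<le> k" "k < j" "j \<le> n" "1 \<le> i" "i \<le> n" "i \<noteq> k" "i \<noteq> j"
  shows "qcommute 1 (E' k j) (f i)"
proof -
  consider (before) "i < k" | (between) "k < i" "i < j" | (after) "j < i" using assms by linarith
  then show ?thesis
  proof cases
    case before
    then have "qcommute 1 (f i) (E' k (Suc n))"
      using qcommute_1_sym[OF E_f_outside[of k n i]] assms by simp
    then have "qcommute 1 (f i) (E' k j)"
      by (rule qcommute_E'_extend) (use assms before in \<open>auto intro: e_f_commute\<close>)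
    then show ?thesis by (rule qcommute_1_sym)
  qed (use assms E'_f_before E'_f_after in auto)
qed

lemma E'_f_first:
  assumes "1 \<le> k" "Suc k < j" "j \<le> Suc n"
  shows "[E' k j, f k]\<^bsub>1\<^esub> = (\<eta> k * (q - p)) \<star> (E' (Suc k) j * w k)"
proof -
  have "qcommute q (w k) (E' (Suc k) j)" "qcommute p (w' k) (E' (Suc k) j)"
    using w_E'[of k "Suc k" j] assms by (simp_all add: wt_simps)
  then have "[\<eta> k \<star> (w k - w' k), E' (Suc k) j]\<^bsub>p\<^esub> = (\<eta> k * (q - p)) \<star> (E' (Suc k) j * w k)"
    by (simp add: qbracket_scaled_diff)
  moreover have "[E' (Suc k) j, f k]\<^bsub>1\<^esub> = 0"
    using E'_f_other[of "Suc k" j k] E_f_outside[of "Suc k" n k] assms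
    by (cases "j = Suc n") (simp_all add: qbracket_eq_0_iff)
  ultimately show ?thesis
    using assms by (simp add: E'_left qbracket_qbracket_derivation e_f)
qed

lemma E'_Suc_f_first:
  assumes "1 \<le> k" "Suc k \<le> n"
  shows "\<exists>x. [E' k (Suc k), f k]\<^bsub>1\<^esub> = x * w k \<and> qcommute (q * q) (E' k (Suc k)) x"
proof -
  define j y c where "j = Suc k" and "y = E' j (Suc j)" and "c = \<eta> k * (q - p)"
  have j_bounds: "k < j" "j \<le> n" "1 \<le> j" using assms by (simp_all add: j_def)
  have "w k * e j = q \<star> (e j * w k)"
    using w_e[of k j] assms by (simp add: qcommute_def wt_simps j_def)
  then have "[y * w k, e j]\<^bsub>bracket_scalar j\<^esub> = (q \<star> (y * e j) - bracket_scalar j \<star> (e j * y)) * w k"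
    by (simp add: qbracket_def scale_mult_simps)
  moreover have "[E' k (Suc j), f k]\<^bsub>1\<^esub> = c \<star> (y * w k)" "[e j, f k]\<^bsub>1\<^esub> = 0"
    using E'_f_first[of k "Suc j"] assms by (simp_all add: j_def c_def y_def e_f)
  ultimately have "[E' k j, f k]\<^bsub>1\<^esub> = (c \<star> (q \<star> (y * e j) - bracket_scalar j \<star> (e j * y))) * w k"
    using j_bounds
    by (simp add: E'_step[of j k] qbracket_qbracket_derivation qbracket_scale scale_mult_left)
  moreover have "qcommute (q * q) (E' k j) (y * e j)" "qcommute (q * q) (E' k j) (e j * y)"
  proof -
    define d where "d = (if j = n then q else q * (p * q))"
    have y_qcommute: "qcommute d (E' k j) y"
      using E'_qcommute_E'[of k j "Suc j"] E'_qcommute_E[of k n n] assms(1) j_bounds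
      by (cases "j = n") (simp_all add: d_def y_def)
    have d_scalar: "d * adjacent_scalar j = q * q"
      using p_nz by (simp add: d_def adjacent_scalar_def)
    show "qcommute (q * q) (E' k j) (y * e j)"
      using qcommute_mult_right[OF y_qcommute E'_last[of k j]] assms(1) j_bounds
      by (simp add: d_scalar)
    show "qcommute (q * q) (E' k j) (e j * y)"
      using qcommute_mult_right[OF E'_last[of k j] y_qcommute] assms(1) j_bounds
      by (simp add: d_scalar mult.commute[of _ d])
  qed
  ultimately show ?thesis
    unfolding j_def by (blast intro: qcommute_scale_right qcommute_diff_right)
qed

definition commutes_with_generators :: "'a \<Rightarrow> bool" where
  "commutes_with_generators x \<longleftrightarrow> (\<forall>i. 1 \<le> i \<and> i \<le> n \<longrightarrow>
    qcommute 1 x (e i) \<and> qcommute 1 x (f i) \<and> qcommute 1 x (w i) \<and> qcommute 1 x (w' i))"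

lemma commutes_with_e_if_commutes_with_E:
  assumes w'_commutes: "\<And>i. 1 \<le> i \<Longrightarrow> i \<le> n \<Longrightarrow> qcommute 1 x (w' i)"
    and f_commutes: "\<And>i. k < i \<Longrightarrow> i \<le> n \<Longrightarrow> qcommute 1 x (f i)"
    and "1 \<le> k" "k \<le> j" "j \<le> n" "qcommute 1 x (E k j)"
  shows "qcommute 1 x (e k)"
  using assms(4-)
proof (induction rule: dec_induct)
  case (step m)
  obtain v where v_inverse: "w' (Suc m) * v = 1" using w'_invertible[of "Suc m"] step by auto
  have "qcommute 1 x [E k (Suc m), f (Suc m)]\<^bsub>1\<^esub>"
    using step f_commutes by (intro qcommute_qbracket_right_1) auto
  then have "qcommute 1 x ((\<eta> (Suc m) * (p * inverse q - 1)) \<star> (E k m * w' (Suc m)))"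
    using E_f_last[of k m] assms(3) step by simp
  moreover have "\<eta> (Suc m) * (p * inverse q - 1) \<noteq> 0"
    using \<eta>_nz[of "Suc m"] p_ne_q q_nz step by (simp add: field_simps)
  ultimately have "qcommute 1 x (E k m)"
    using qcommute_cancel_right w'_commutes[of "Suc m"] v_inverse step by auto
  then show ?case using step by simp
qed simp

lemma commutes_with_e_if_commutes_with_E':
  assumes w'_commutes: "\<And>i. 1 \<le> i \<Longrightarrow> i \<le> n \<Longrightarrow> qcommute 1 x (w' i)"
    and f_commutes: "\<And>i. k < i \<Longrightarrow> i \<le> n \<Longrightarrow> qcommute 1 x (f i)"
    and "1 \<le> k" "k < j" "j \<le> Suc n" "qcommute 1 x (E' k j)"
  shows "qcommute 1 x (e k)"
  using assms(5,4,6)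
proof (induction rule: inc_induct)
  case base
  then show ?case
    using commutes_with_e_if_commutes_with_E[OF w'_commutes f_commutes, of k n] assms(3) by simp
next
  case (step i)
  obtain v where v_inverse: "w' i * v = 1" using w'_invertible[of i] step by auto
  obtain c where commutator: "c \<noteq> 0" "[E' k i, f i]\<^bsub>1\<^esub> = c \<star> (E' k (Suc i) * w' i)"
    using E'_f_last[of k i] assms(3) step by auto
  have "qcommute 1 x [E' k i, f i]\<^bsub>1\<^esub>"
    using step f_commutes by (intro qcommute_qbracket_right_1) auto
  then have "qcommute 1 x (E' k (Suc i))"
    using qcommute_cancel_right commutator w'_commutes[of i] v_inverse step by auto
  then show ?case using step by simp
qed

lemma commutes_with_generatorsI:
  assumes k_bounds: "1 \<le> k" "k \<le> n"
    and w_commutes: "\<And>i. 1 \<le> i \<Longrightarrow> i \<le> n \<Longrightarrow> qcommute 1 x (w i)"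
    and w'_commutes: "\<And>i. 1 \<le> i \<Longrightarrow> i \<le> n \<Longrightarrow> qcommute 1 x (w' i)"
    and f_commutes: "\<And>i. 1 \<le> i \<Longrightarrow> i \<le> n \<Longrightarrow> qcommute 1 x (f i)"
    and e_commutes: "\<And>i. k \<le> i \<Longrightarrow> i \<le> n \<Longrightarrow> qcommute 1 x (e i)"
      "\<And>i. 1 \<le> i \<Longrightarrow> Suc i < k \<Longrightarrow> qcommute 1 x (e i)"
    and E'_commutes: "\<And>m. 1 \<le> m \<Longrightarrow> k = Suc m \<Longrightarrow> qcommute 1 x (E' m k)"
  shows "commutes_with_generators x"
proof -
  have "qcommute 1 x (e i)" if "1 \<le> i" "k = Suc i" for i
    using commutes_with_e_if_commutes_with_E'[OF w'_commutes f_commutes, of i k] E'_commutes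
      k_bounds that by auto
  moreover have "k \<le> i \<or> k = Suc i \<or> Suc i < k" for i by linarith
  ultimately show ?thesis
    using w_commutes w'_commutes f_commutes e_commutes
    unfolding commutes_with_generators_def by metis
qed

end

section \<open>Powers of root vectors\<close>

locale type_B_root_of_unity = type_B_quantum_group scale n p q t e f w w' \<eta>
  for scale :: "'k::field \<Rightarrow> 'a::ring_1 \<Rightarrow> 'a" (infixr "\<star>" 75) and n p q t e f w w' \<eta> +
  fixes l :: nat
  assumes l_pos: "l > 0" and p_root: "p ^ l = 1" and q_root: "q ^ l = 1" and t_root: "t ^ l = 1"
begin

lemma t_ne_q: "t \<noteq> q"
  using t_square p_ne_q q_nz by auto

lemma wt_root: "wt i m ^ l = 1" "wt' i m ^ l = 1"
  by (simp_all add: eps_scalar_def p_root q_root t_root power_mult_distrib power_inverse)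

lemmas root_simps = p_root q_root t_root wt_root power_mult_distrib power_inverse

lemma E_power_e:
  assumes "1 \<le> k" "k \<le> j" "j < n" "k < i" "i \<le> n"
  shows "qcommute 1 (E k j ^ l) (e i)"
proof -
  consider (between) "i < j" | (last) "i = j" | (adjacent) "i = Suc j" | (after) "Suc j < i"
    by linarith
  then show ?thesis
  proof cases
    case between
    then show ?thesis
      using assms by (intro qcommute_1_power e_commute_E_middle) auto
  next
    case last
    then show ?thesis using power_root_commutes_left[OF E_last[of k j] q_root] assms by simp
  next
    case adjacent
    then show ?thesis
      using power_commutes_if_chain2[OF _ adjacent_E[of k j] p_ne_q p_root q_root, of "e i"] assms
      by (simp add: E_right)
  next
    case after
    then show ?thesis
      using assms by (intro qcommute_1_power e_commute_E) auto
  qed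
qed

lemma E'_power_e:
  assumes "1 \<le> k" "k < j" "j \<le> Suc n" "k < i" "i \<le> n"
  shows "qcommute 1 (E' k j ^ l) (e i)"
proof -
  consider (between) "Suc i < j" | (adjacent) "Suc i = j" | (last) "i = j"
    | (after) "j < i" "i < n" | (after_n) "j < i" "i = n"
    using assms by linarith
  then show ?thesis
  proof cases
    case between
    then show ?thesis
      using assms by (intro qcommute_1_power e_commute_E') auto
  next
    case adjacent
    have "bracket_scalar i \<noteq> adjacent_scalar i" "bracket_scalar i ^ l = 1"
      "adjacent_scalar i ^ l = 1"
      using t_ne_q p_ne_q by (simp_all add: bracket_scalar_def adjacent_scalar_def root_simps)
    then show ?thesis
      using power_commutes_if_chain2[OF _ adjacent_E'[of k i], of "e i"] adjacent assms
      by (simp add: E'_step[of i])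
  next
    case last
    moreover have "adjacent_scalar j ^ l = 1" by (simp add: adjacent_scalar_def root_simps)
    ultimately show ?thesis using power_root_commutes_left[OF E'_last[of k j]] assms by simp
  next
    case after
    then show ?thesis
      using assms by (intro qcommute_1_power E'_after) auto
  next
    case after_n
    then show ?thesis
      using power_root_commutes_left[OF E'_after_n[of k j]] assms by (simp add: root_simps)
  qed
qed

lemma e_power_f:
  assumes "1 \<le> k" "k \<le> n"
  shows "qcommute 1 (e k ^ l) (f k)"
proof -
  define c where "c = wt k k * inverse (wt k (Suc k))"
  have wt'_eq: "wt' k k * inverse (wt' k (Suc k)) = inverse c"
    using assms t_square t_nz p_nz q_nz by (auto simp: c_def wt_simps field_simps)
  have c_root: "c \<noteq> 0" "c ^ l = 1" using wt_nz by (simp_all add: c_def root_simps)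
  have c_square: "c * c \<noteq> 1"
  proof (cases "k = n")
    case True
    then show ?thesis
      using t_square t_nz p_nz p_ne_q by (auto simp: c_def eps_scalar_def field_simps)
  next
    case False
    have "(p - q) * (p + q) \<noteq> 0" using p_ne_q p_plus_q_nz by simp
    then show ?thesis using False q_nz by (auto simp: c_def eps_scalar_def field_simps)
  qed
  have torus: "qcommute (inverse c) (e k) (w k)" "qcommute c (e k) (w' k)"
    using w_e[of k k] w'_e[of k k] assms c_root(1) qcommute_inverse_iff[of "inverse c" "e k" "w' k"]
    by (simp_all add: wt'_eq qcommute_inverse_iff flip: c_def)
  show ?thesis
  proof (rule power_commutes_if_chain3)
    show "[e k, f k]\<^bsub>1\<^esub> = \<eta> k \<star> (w k - w' k)" using assms by (simp add: e_f)
    show "[e k, \<eta> k \<star> (w k - w' k)]\<^bsub>inverse c\<^esub> = (\<eta> k * (inverse c - c)) \<star> (w' k * e k)"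
      using torus by (simp add: qbracket_def qcommute_def scale_mult_simps)
    show "qcommute c (e k) ((\<eta> k * (inverse c - c)) \<star> (w' k * e k))"
      using qcommute_mult_right[OF torus(2), of 1 "e k"]
      by (auto intro!: qcommute_scale_right simp: qcommute_1_iff)
    show "distinct [1, inverse c, c]" using c_root c_square by (auto simp: field_simps)
  qed (simp_all add: c_root(2) power_inverse)
qed

lemma E_power_f_last:
  assumes "1 \<le> k" "k < j" "j \<le> n"
  shows "qcommute 1 (E k j ^ l) (f j)"
proof -
  obtain m where j_Suc: "j = Suc m" using assms by (cases j) auto
  define a where "a = wt' j k * inverse (wt' j (Suc j))"
  show ?thesis
  proof (rule power_commutes_if_commutator)
    show "[E k j, f j]\<^bsub>1\<^esub> = (\<eta> j * (p * inverse q - 1)) \<star> (E k m * w' j)"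
      using E_f_last[of k m] assms j_Suc by simp
    show "qcommute (inverse q) (E k j) (E k m)"
      using adjacent_E[of k m] q_nz assms j_Suc by (simp add: qcommute_inverse_iff)
    show "qcommute a (w' j) (E k j)" using w_E(2)[of j k j] assms by (simp add: a_def)
    show "inverse q \<noteq> a" using assms p_ne_q t_ne_q by (auto simp: a_def eps_scalar_def)
  qed (simp_all add: a_def root_simps)
qed

lemma E_power_f_first:
  assumes "1 \<le> k" "k < j" "j < n"
  shows "qcommute 1 (E k j ^ l) (f k)"
proof (rule power_commutes_if_commutator)
  show "[E k j, f k]\<^bsub>1\<^esub> = (\<eta> k * (q - p)) \<star> (E (Suc k) j * w k)"
    using assms by (simp add: E_f_first)
  show "qcommute q (E k j) (E (Suc k) j)" using assms by (rule E_qcommute_E_next_row)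
  show "qcommute p (w k) (E k j)" using w_E(1)[of k k j] assms by (simp add: wt_simps)
qed (use p_ne_q in \<open>simp_all add: root_simps\<close>)

lemma E_n_power_f_first:
  assumes "1 \<le> k" "k < n"
  shows "qcommute 1 (E k n ^ l) (f k)"
proof (rule power_commutes_if_chain3)
  define c where "c = \<eta> k * (q - p)"
  have E_w: "qcommute (inverse p) (E k n) (w k)"
    using w_E(1)[of k k n] p_nz assms by (simp add: wt_simps qcommute_inverse_iff)
  show "[E k n, f k]\<^bsub>1\<^esub> = c \<star> (E (Suc k) n * w k)"
    using assms by (simp add: E_f_first c_def)
  show "[E k n, c \<star> (E (Suc k) n * w k)]\<^bsub>t * inverse p\<^esub> = c \<star> ([E k n, E (Suc k) n]\<^bsub>t\<^esub> * w k)"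
    using E_w by (simp add: qbracket_scale qbracket_mult_right flip: qbracket_eq_0_iff)
  show "qcommute (q * inverse p) (E k n) (c \<star> ([E k n, E (Suc k) n]\<^bsub>t\<^esub> * w k))"
    using E_n_qcommute_qbracket_E_next_row[OF assms] E_w
    by (intro qcommute_scale_right qcommute_mult_right)
  have "t \<noteq> p" using t_square p_ne_q p_nz by auto
  then show "distinct [1, t * inverse p, q * inverse p]"
    using p_nz p_ne_q t_ne_q by (auto simp: field_simps)
qed (simp_all add: root_simps)

lemma E_power_f:
  assumes "1 \<le> k" "k \<le> j" "j \<le> n" "1 \<le> i" "i \<le> n"
  shows "qcommute 1 (E k j ^ l) (f i)"
proof -
  consider (outside) "i < k \<or> j < i" | (between) "k < i" "i < j" | "i = k" "k = j"
    | "k < j" "i = j" | "k < j" "i = k" "j < n" | "k < j" "i = k" "j = n"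
    using assms by linarith
  then show ?thesis
  proof cases
    case outside
    then show ?thesis using power_root_commutes_left[OF E_f_outside[of k j i]] assms by simp
  next
    case between
    then show ?thesis using power_root_commutes_left[OF E_f_middle[of k i j]] assms by simp
  qed (use assms e_power_f E_power_f_last E_power_f_first E_n_power_f_first in auto)
qed

lemma E'_power_f_last:
  assumes "1 \<le> k" "k < j" "j \<le> n"
  shows "qcommute 1 (E' k j ^ l) (f j)"
proof -
  obtain c where commutator: "[E' k j, f j]\<^bsub>1\<^esub> = c \<star> (E' k (Suc j) * w' j)"
    using E'_f_last[OF assms] by blast
  show ?thesis
  proof (rule power_commutes_if_commutator[OF commutator])
    show "qcommute (inverse (adjacent_scalar j)) (E' k j) (E' k (Suc j))"
      using adjacent_E'[OF assms] p_nz q_nz by (simp add: adjacent_scalar_def qcommute_inverse_iff)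
    show "qcommute (wt' j k * wt' j j) (w' j) (E' k j)" using w_E'(2)[of j k j] assms by simp
    have "t * t \<noteq> q * q" using t_square p_ne_q q_nz by simp
    then show "inverse (adjacent_scalar j) \<noteq> wt' j k * wt' j j"
      using assms p_nz q_nz t_nz p_ne_q t_square
      by (auto simp: adjacent_scalar_def eps_scalar_def field_simps)
  qed (simp_all add: adjacent_scalar_def root_simps)
qed

lemma E'_power_f_first:
  assumes "1 \<le> k" "k < j" "j \<le> n"
  shows "qcommute 1 (E' k j ^ l) (f k)"
proof (cases "j = Suc k")
  case True
  obtain x where commutator: "[E' k j, f k]\<^bsub>1\<^esub> = x * w k" "qcommute (q * q) (E' k j) x"
    using E'_Suc_f_first[of k] assms True by auto
  show ?thesis
  proof (rule power_commutes_if_commutator)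
    show "[E' k j, f k]\<^bsub>1\<^esub> = 1 \<star> (x * w k)" using commutator by simp
    show "qcommute (p * q) (w k) (E' k j)"
      using w_E'(1)[of k k j] assms True by (simp add: wt_simps)
    show "q * q \<noteq> p * q" using p_ne_q q_nz by auto
  qed (simp_all add: commutator root_simps)
next
  case False
  show ?thesis
  proof (rule power_commutes_if_commutator)
    show "[E' k j, f k]\<^bsub>1\<^esub> = (\<eta> k * (q - p)) \<star> (E' (Suc k) j * w k)"
      using assms False by (simp add: E'_f_first)
    show "qcommute q (E' k j) (E' (Suc k) j)"
      using assms False by (simp add: E'_qcommute_E'_next_row)
    show "qcommute p (w k) (E' k j)" using w_E'(1)[of k k j] assms False by (simp add: wt_simps)
  qed (use p_ne_q in \<open>simp_all add: root_simps\<close>)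
qed

lemma E'_power_f:
  assumes "1 \<le> k" "k < j" "j \<le> n" "1 \<le> i" "i \<le> n"
  shows "qcommute 1 (E' k j ^ l) (f i)"
proof -
  consider "i = k" | "i = j" | (other) "i \<noteq> k" "i \<noteq> j" by blast
  then show ?thesis
  proof cases
    case other
    then show ?thesis using power_root_commutes_left[OF E'_f_other[of k j i]] assms by simp
  qed (use assms E'_power_f_last E'_power_f_first in auto)
qed

theorem E_power_commutes_with_generators:
  assumes "1 \<le> k" "k \<le> j" "j \<le> n"
  shows "commutes_with_generators (E k j ^ l)"
proof (rule commutes_with_generatorsI[of k])
  show f_commutes: "qcommute 1 (E k j ^ l) (f i)" if "1 \<le> i" "i \<le> n" for i
    using assms that by (rule E_power_f)
  show "qcommute 1 (E k j ^ l) (w i)" if "1 \<le> i" "i \<le> n" for i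
    using power_root_commutes_right[OF w_E(1)[of i k j]] l_pos assms that by (simp add: root_simps)
  show w'_commutes: "qcommute 1 (E k j ^ l) (w' i)" if "1 \<le> i" "i \<le> n" for i
    using power_root_commutes_right[OF w_E(2)[of i k j]] l_pos assms that by (simp add: root_simps)
  show "qcommute 1 (E k j ^ l) (e i)" if "1 \<le> i" "Suc i < k" for i
    using assms that by (intro qcommute_1_power e_commute_E) auto
  show "qcommute 1 (E k j ^ l) (E' m k)" if "1 \<le> m" "k = Suc m" for m
    using power_root_commutes_right[OF E'_qcommute_E[of m k j]] l_pos assms that
    by (simp add: root_simps)
  show "qcommute 1 (E k j ^ l) (e i)" if i_bounds: "k \<le> i" "i \<le> n" for i
  proof -
    consider (first) "i = k" | (inner) "k < i" "j < n" | (top) "k < i" "j = n"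
      using i_bounds assms by linarith
    then show ?thesis
    proof cases
      case first
      have "qcommute 1 (E k j ^ l) (E k j)" by (simp add: qcommute_1_iff power_commutes)
      then show ?thesis
        using commutes_with_e_if_commutes_with_E[OF w'_commutes f_commutes, of k j] assms first
        by simp
    next
      case inner
      then show ?thesis using E_power_e assms i_bounds by simp
    next
      case top
      then show ?thesis using E'_power_e[of k "Suc n" i] assms i_bounds by simp
    qed
  qed
qed (use assms in auto)

theorem E'_power_commutes_with_generators:
  assumes "1 \<le> k" "k < j" "j \<le> n"
  shows "commutes_with_generators (E' k j ^ l)"
proof (rule commutes_with_generatorsI[of k])
  show f_commutes: "qcommute 1 (E' k j ^ l) (f i)" if "1 \<le> i" "i \<le> n" for i
    using assms that by (rule E'_power_f)
  show "qcommute 1 (E' k j ^ l) (w i)" if "1 \<le> i" "i \<le> n" for i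
    using power_root_commutes_right[OF w_E'(1)[of i k j]] l_pos assms that by (simp add: root_simps)
  show w'_commutes: "qcommute 1 (E' k j ^ l) (w' i)" if "1 \<le> i" "i \<le> n" for i
    using power_root_commutes_right[OF w_E'(2)[of i k j]] l_pos assms that by (simp add: root_simps)
  show "qcommute 1 (E' k j ^ l) (e i)" if "1 \<le> i" "Suc i < k" for i
  proof -
    have "qcommute 1 (e i) (E' k (Suc n))" using assms that by (simp add: e_commute_E)
    then have "qcommute 1 (e i) (E' k j)"
      by (rule qcommute_E'_extend) (use assms that in \<open>auto intro: e_commute\<close>)
    then show ?thesis by (rule qcommute_1_power)
  qed
  show "qcommute 1 (E' k j ^ l) (E' m k)" if "1 \<le> m" "k = Suc m" for m
    using power_root_commutes_right[OF E'_qcommute_E'[of m k j]] l_pos assms that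
    by (simp add: root_simps)
  show "qcommute 1 (E' k j ^ l) (e i)" if "k \<le> i" "i \<le> n" for i
  proof (cases "i = k")
    case True
    have "qcommute 1 (E' k j ^ l) (E' k j)" by (simp add: qcommute_1_iff power_commutes)
    then show ?thesis
      using commutes_with_e_if_commutes_with_E'[OF w'_commutes f_commutes, of k j] assms True
      by simp
  next
    case False
    then show ?thesis using E'_power_e[of k j i] assms that by simp
  qed
qed (use assms in auto)

theorem w_power_commutes_with_generators:
  assumes "1 \<le> k" "k \<le> n"
  shows "commutes_with_generators (w k ^ l)" "commutes_with_generators (w' k ^ l)"
proof -
  have "qcommute 1 (w k ^ l) (e i)" "qcommute 1 (w k ^ l) (f i)" "qcommute 1 (w k ^ l) (w i)"
    "qcommute 1 (w k ^ l) (w' i)" "qcommute 1 (w' k ^ l) (e i)" "qcommute 1 (w' k ^ l) (f i)"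
    "qcommute 1 (w' k ^ l) (w i)" "qcommute 1 (w' k ^ l) (w' i)" if "1 \<le> i" "i \<le> n" for i
    using power_root_commutes_left[OF w_e[of k i]] power_root_commutes_left[OF w_f[of k i]]
      power_root_commutes_left[OF w_w[of k i]] power_root_commutes_left[OF w_w'[of k i]]
      power_root_commutes_left[OF w'_e[of k i]] power_root_commutes_left[OF w'_f[of k i]]
      power_root_commutes_left[OF qcommute_1_sym[OF w_w'[of i k]]]
      power_root_commutes_left[OF w'_w'[of k i]]
      assms that by (simp_all add: root_simps)
  then show "commutes_with_generators (w k ^ l)" "commutes_with_generators (w' k ^ l)"
    by (simp_all add: commutes_with_generators_def)
qed

end

section \<open>The relations of \<open>U\<^sub>r\<^sub>,\<^sub>s(so\<^sub>2\<^sub>n\<^sub>+\<^sub>1)\<close>\<close>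

text \<open>The left adjoint action of \<open>x\<close> with coproduct \<open>x \<otimes> 1 + v \<otimes> x\<close> and the right adjoint action of
  \<open>x\<close> with coproduct \<open>1 \<otimes> x + x \<otimes> v\<close>, where \<open>v'\<close> is the inverse of \<open>v\<close>.\<close>

definition left_adjoint :: "'a::ring_1 \<Rightarrow> 'a \<Rightarrow> 'a \<Rightarrow> 'a \<Rightarrow> 'a" where
  "left_adjoint x v v' y = x * y - v * y * v' * x"

definition right_adjoint :: "'a::ring_1 \<Rightarrow> 'a \<Rightarrow> 'a \<Rightarrow> 'a \<Rightarrow> 'a" where
  "right_adjoint x v v' y = y * x - x * v' * y * v"

lemma (in scalar_algebra) left_adjoint_funpow_Suc:
  assumes "qcommute a v x" "qcommute b v y" "v * v' = 1"
  shows "(left_adjoint x v v' ^^ Suc m) y = [x, (left_adjoint x v v' ^^ m) y]\<^bsub>a ^ m * b\<^esub>"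
proof -
  have left_adjoint: "left_adjoint x v v' z = [x, z]\<^bsub>c\<^esub>" if "qcommute c v z" for c z
  proof -
    have "v * z * v' = c \<star> (z * (v * v'))"
      using that by (simp add: qcommute_def scale_mult_left mult.assoc)
    then show ?thesis using assms(3) by (simp add: left_adjoint_def qbracket_def scale_mult_left)
  qed
  have "qcommute (a ^ m * b) v ((left_adjoint x v v' ^^ m) y)"
  proof (induction m)
    case (Suc m)
    then show ?case
      using qcommute_qbracket_right[OF assms(1) Suc] by (simp add: left_adjoint mult.assoc)
  qed (simp add: assms(2))
  then show ?thesis by (simp add: left_adjoint)
qed

lemma pairing_eq_eps_scalar:
  assumes "1 \<le> i" "i \<le> n" "1 \<le> j" "j \<le> n" "r \<noteq> 0" "s \<noteq> 0"
  shows "pairing n r s j i = eps_scalar n (r ^ 2) (s ^ 2) (r * s) i j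
      * inverse (eps_scalar n (r ^ 2) (s ^ 2) (r * s) i (Suc j))"
    and "pairing n r s i j = eps_scalar n (s ^ 2) (r ^ 2) (r * s) i (Suc j)
      * inverse (eps_scalar n (s ^ 2) (r ^ 2) (r * s) i j)"
  using assms by (auto simp: pairing_def eps_scalar_def field_simps power2_eq_square)

locale two_parameter_so_root_of_unity = scalar_algebra scale
  for scale :: "'k::field \<Rightarrow> 'a::ring_1 \<Rightarrow> 'a" (infixr "\<star>" 75) +
  fixes n l :: nat and r s :: 'k and e f w wi w' wi' :: "nat \<Rightarrow> 'a"
  assumes l_pos: "l > 0" and r_root: "r ^ l = 1" and s_root: "s ^ l = 1"
    and cubes_ne: "r ^ 3 \<noteq> s ^ 3" and fourth_powers_ne: "r ^ 4 \<noteq> s ^ 4"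
    and w_wi: "i \<in> {1..n} \<Longrightarrow> w i * wi i = 1" "i \<in> {1..n} \<Longrightarrow> wi i * w i = 1"
    and w'_wi': "i \<in> {1..n} \<Longrightarrow> w' i * wi' i = 1" "i \<in> {1..n} \<Longrightarrow> wi' i * w' i = 1"
    and w_w: "i \<in> {1..n} \<Longrightarrow> j \<in> {1..n} \<Longrightarrow> qcommute 1 (w i) (w j)"
    and w_w': "i \<in> {1..n} \<Longrightarrow> j \<in> {1..n} \<Longrightarrow> qcommute 1 (w i) (w' j)"
    and w'_w': "i \<in> {1..n} \<Longrightarrow> j \<in> {1..n} \<Longrightarrow> qcommute 1 (w' i) (w' j)"
    and w_e: "i \<in> {1..n} \<Longrightarrow> j \<in> {1..n} \<Longrightarrow> qcommute (pairing n r s i j) (w j) (e i)"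
    and w_f: "i \<in> {1..n} \<Longrightarrow> j \<in> {1..n} \<Longrightarrow> qcommute (inverse (pairing n r s i j)) (w j) (f i)"
    and w'_e: "i \<in> {1..n} \<Longrightarrow> j \<in> {1..n} \<Longrightarrow> qcommute (inverse (pairing n r s j i)) (w' j) (e i)"
    and w'_f: "i \<in> {1..n} \<Longrightarrow> j \<in> {1..n} \<Longrightarrow> qcommute (pairing n r s j i) (w' j) (f i)"
    and e_f: "i \<in> {1..n} \<Longrightarrow> j \<in> {1..n} \<Longrightarrow>
      [e i, f j]\<^bsub>1\<^esub> = (if i = j then inverse (rr n r i - rr n s i) \<star> (w i - w' i) else 0)"
    and serre_e: "i \<in> {1..n} \<Longrightarrow> j \<in> {1..n} \<Longrightarrow> i \<noteq> j \<Longrightarrow>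
      (left_adjoint (e i) (w i) (wi i) ^^ nat (1 - cartan n i j)) (e j) = 0"
    and serre_f: "i \<in> {1..n} \<Longrightarrow> j \<in> {1..n} \<Longrightarrow> i \<noteq> j \<Longrightarrow>
      (right_adjoint (f i) (w' i) (wi' i) ^^ nat (1 - cartan n i j)) (f j) = 0"
begin

lemma r_nz: "r \<noteq> 0" and s_nz: "s \<noteq> 0"
  using r_root s_root l_pos by (auto simp: power_0_left)

lemma squares_ne: "r ^ 2 \<noteq> s ^ 2" and sum_squares_nz: "r ^ 2 + s ^ 2 \<noteq> 0"
proof -
  have "(r ^ 2 - s ^ 2) * (r ^ 2 + s ^ 2) = r ^ 4 - s ^ 4"
    by (simp add: algebra_simps flip: power_add)
  then show "r ^ 2 \<noteq> s ^ 2" "r ^ 2 + s ^ 2 \<noteq> 0" using fourth_powers_ne by auto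
qed

lemma sum_cubes_factor_nz: "r ^ 2 + r * s + s ^ 2 \<noteq> 0"
proof -
  have "(r - s) * (r ^ 2 + r * s + s ^ 2) = r ^ 3 - s ^ 3"
    by (simp add: algebra_simps power2_eq_square power3_eq_cube)
  then show ?thesis using cubes_ne by auto
qed

lemma serre_e_qbracket:
  assumes "i \<in> {1..n}" "j \<in> {1..n}" "i \<noteq> j"
  shows "cartan n i j = 0 \<Longrightarrow> qcommute (pairing n r s j i) (e i) (e j)"
    and "cartan n i j = - 1 \<Longrightarrow>
      qcommute (pairing n r s i i * pairing n r s j i) (e i) [e i, e j]\<^bsub>pairing n r s j i\<^esub>"
    and "cartan n i j = - 2 \<Longrightarrow>
      qcommute (pairing n r s i i ^ 2 * pairing n r s j i) (e i)
        [e i, [e i, e j]\<^bsub>pairing n r s j i\<^esub>]\<^bsub>pairing n r s i i * pairing n r s j i\<^esub>"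
proof -
  note step = left_adjoint_funpow_Suc[OF w_e[OF assms(1,1)] w_e[OF assms(2,1)] w_wi(1)[OF assms(1)]]
  note serre = serre_e[OF assms]
  show "cartan n i j = 0 \<Longrightarrow> qcommute (pairing n r s j i) (e i) (e j)"
    using serre step[of 0] by (simp add: qbracket_eq_0_iff)
  show "cartan n i j = - 1 \<Longrightarrow>
      qcommute (pairing n r s i i * pairing n r s j i) (e i) [e i, e j]\<^bsub>pairing n r s j i\<^esub>"
    using serre step[of 0] step[of 1] by (simp add: qbracket_eq_0_iff numeral_2_eq_2)
  show "cartan n i j = - 2 \<Longrightarrow>
      qcommute (pairing n r s i i ^ 2 * pairing n r s j i) (e i)
        [e i, [e i, e j]\<^bsub>pairing n r s j i\<^esub>]\<^bsub>pairing n r s i i * pairing n r s j i\<^esub>"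
    using serre step[of 0] step[of 1] step[of 2]
    by (simp add: qbracket_eq_0_iff numeral_2_eq_2 numeral_3_eq_3)
qed

lemma e_far:
  assumes "1 \<le> i" "Suc i < j" "j \<le> n"
  shows "qcommute 1 (e i) (e j)"
proof -
  have "cartan n i j = 0" "pairing n r s j i = 1" using assms by (auto simp: cartan_def pairing_def)
  then show ?thesis using serre_e_qbracket(1)[of i j] assms by simp
qed

lemma serre_up:
  assumes "1 \<le> i" "i < n"
  shows "qcommute (s ^ 2) (e i) [e i, e (Suc i)]\<^bsub>r ^ 2\<^esub>"
proof -
  have "cartan n i (Suc i) = - 1" "pairing n r s (Suc i) i = s ^ 2"
    "pairing n r s i i * pairing n r s (Suc i) i = r ^ 2"
    using assms s_nz by (auto simp: cartan_def pairing_def)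
  then show ?thesis
    using serre_e_qbracket(2)[of i "Suc i"] assms by (simp add: qcommute_exchange_scalars(1))
qed

lemma serre_down:
  assumes "1 \<le> i" "Suc i < n"
  shows "qcommute (s ^ 2) [e i, e (Suc i)]\<^bsub>r ^ 2\<^esub> (e (Suc i))"
proof -
  have "cartan n (Suc i) i = - 1" "pairing n r s i (Suc i) = inverse (r ^ 2)"
    "pairing n r s (Suc i) (Suc i) * pairing n r s i (Suc i) = inverse (s ^ 2)"
    using assms r_nz by (auto simp: cartan_def pairing_def)
  then have "qcommute (inverse (s ^ 2)) (e (Suc i)) [e (Suc i), e i]\<^bsub>inverse (r ^ 2)\<^esub>"
    using serre_e_qbracket(2)[of "Suc i" i] assms by simp
  moreover have "[e i, e (Suc i)]\<^bsub>r ^ 2\<^esub> = - (r ^ 2) \<star> [e (Suc i), e i]\<^bsub>inverse (r ^ 2)\<^esub>"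
    by (rule qbracket_swap) (simp add: r_nz)
  ultimately have "qcommute (inverse (s ^ 2)) (e (Suc i)) [e i, e (Suc i)]\<^bsub>r ^ 2\<^esub>"
    by (simp only: qcommute_scale_right)
  then show ?thesis using s_nz by (simp add: qcommute_inverse_iff)
qed

lemma serre_last:
  assumes "1 \<le> i" "Suc i = n"
  shows "qcommute (s ^ 2) [[e i, e n]\<^bsub>r ^ 2\<^esub>, e n]\<^bsub>r * s\<^esub> (e n)"
proof -
  have "cartan n n i = - 2" "pairing n r s i n = inverse (r ^ 2)"
    "pairing n r s n n * pairing n r s i n = inverse (r * s)"
    "pairing n r s n n ^ 2 * pairing n r s i n = inverse (s ^ 2)"
    using assms r_nz s_nz by (auto simp: cartan_def pairing_def field_simps power2_eq_square)
  then have "qcommute (inverse (s ^ 2)) (e n) [e n, [e n, e i]\<^bsub>inverse (r ^ 2)\<^esub>]\<^bsub>inverse (r * s)\<^esub>"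
    using serre_e_qbracket(3)[of n i] assms by simp
  moreover have "[e i, e n]\<^bsub>r ^ 2\<^esub> = - (r ^ 2) \<star> [e n, e i]\<^bsub>inverse (r ^ 2)\<^esub>"
    by (rule qbracket_swap) (simp add: r_nz)
  moreover have "[[e n, e i]\<^bsub>inverse (r ^ 2)\<^esub>, e n]\<^bsub>r * s\<^esub>
      = - (r * s) \<star> [e n, [e n, e i]\<^bsub>inverse (r ^ 2)\<^esub>]\<^bsub>inverse (r * s)\<^esub>"
    by (rule qbracket_swap) (simp add: r_nz s_nz del: inverse_mult_distrib)
  ultimately have "qcommute (inverse (s ^ 2)) (e n) [[e i, e n]\<^bsub>r ^ 2\<^esub>, e n]\<^bsub>r * s\<^esub>"
    by (simp only: qbracket_scale qcommute_scale_right)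
  then show ?thesis using s_nz by (simp add: qcommute_inverse_iff)
qed

sublocale type_B_root_of_unity scale n "r ^ 2" "s ^ 2" "r * s" e f w w'
  "\<lambda>i. inverse (rr n r i - rr n s i)" l
proof
  fix i j assume i_range: "1 \<le> i" "i \<le> n"
  show "inverse (rr n r i - rr n s i) \<noteq> 0" using squares_ne by (auto simp: rr_def)
  show "\<exists>v. w' i * v = 1" using w'_wi' i_range by auto
  assume j_range: "1 \<le> j" "j \<le> n"
  show "qcommute 1 (w i) (w j)" "qcommute 1 (w i) (w' j)" "qcommute 1 (w' i) (w' j)"
    using w_w w_w' w'_w' i_range j_range by simp_all
  let ?wt = "eps_scalar n (r ^ 2) (s ^ 2) (r * s)" and ?wt' = "eps_scalar n (s ^ 2) (r ^ 2) (r * s)"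
  note pairing = pairing_eq_eps_scalar[OF i_range j_range r_nz s_nz]
  show "qcommute (?wt i j * inverse (?wt i (Suc j))) (w i) (e j)"
    "qcommute (?wt i (Suc j) * inverse (?wt i j)) (w i) (f j)"
    using w_e[of j i] w_f[of j i] i_range j_range by (simp_all add: pairing(1) mult.commute)
  show "qcommute (?wt' i j * inverse (?wt' i (Suc j))) (w' i) (e j)"
    "qcommute (?wt' i (Suc j) * inverse (?wt' i j)) (w' i) (f j)"
    using w'_e[of j i] w'_f[of j i] i_range j_range by (simp_all add: pairing(2) mult.commute)
  show "[e i, f j]\<^bsub>1\<^esub> = (if i = j then inverse (rr n r i - rr n s i) \<star> (w i - w' i) else 0)"
    using e_f i_range j_range by simp
qed (use r_nz s_nz r_root s_root l_pos squares_ne sum_squares_nz sum_cubes_factor_nz serre_up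
      serre_down serre_last e_far in \<open>simp_all add: power2_eq_square power_mult_distrib mult_ac\<close>)

end

section \<open>The opposite algebra\<close>

datatype 'a opposite = Op (unop: 'a)

instantiation opposite :: (ring_1) ring_1
begin
definition "0 = Op 0"
definition "1 = Op 1"
definition "- x = Op (- unop x)"
definition "x + y = Op (unop x + unop y)"
definition "x - y = Op (unop x - unop y)" for x y :: "'a opposite"
definition "x * y = Op (unop y * unop x)"
instance
  by standard (simp_all add: zero_opposite_def one_opposite_def uminus_opposite_def
      plus_opposite_def minus_opposite_def times_opposite_def algebra_simps)
end

lemmas Op_simps = zero_opposite_def one_opposite_def uminus_opposite_def plus_opposite_def
  minus_opposite_def times_opposite_def

lemma Op_power: "Op x ^ m = Op (x ^ m)"
  by (induction m) (simp_all add: Op_simps power_commutes)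

lemma left_adjoint_funpow_Op:
  "(left_adjoint (Op x) (Op v) (Op v') ^^ m) (Op y) = Op ((right_adjoint x v v' ^^ m) y)"
  by (induction m) (simp_all add: left_adjoint_def right_adjoint_def Op_simps mult.assoc)

lemma right_adjoint_funpow_Op:
  "(right_adjoint (Op x) (Op v) (Op v') ^^ m) (Op y) = Op ((left_adjoint x v v' ^^ m) y)"
  by (induction m) (simp_all add: left_adjoint_def right_adjoint_def Op_simps mult.assoc)

definition opposite_scale :: "('k \<Rightarrow> 'a \<Rightarrow> 'a) \<Rightarrow> 'k \<Rightarrow> 'a opposite \<Rightarrow> 'a opposite" where
  "opposite_scale scale c x = Op (scale c (unop x))"

context scalar_algebra
begin

lemma opposite_scalar_algebra: "scalar_algebra (opposite_scale scale)"
  by standard (simp_all add: opposite_scale_def Op_simps scale_mult_simps)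

lemma opposite_qbracket:
  "scalar_algebra.qbracket (opposite_scale scale) (Op x) (Op y) c = Op [y, x]\<^bsub>c\<^esub>"
  by (simp add: scalar_algebra.qbracket_def[OF opposite_scalar_algebra] qbracket_def
    opposite_scale_def Op_simps)

lemma opposite_qcommute:
  "scalar_algebra.qcommute (opposite_scale scale) c (Op x) (Op y) \<longleftrightarrow> qcommute c y x"
  by (simp add: scalar_algebra.qcommute_def[OF opposite_scalar_algebra] qcommute_def
    opposite_scale_def Op_simps)

end

lemma pairing_swap: "r \<noteq> 0 \<Longrightarrow> s \<noteq> 0 \<Longrightarrow> pairing n s r i j = inverse (pairing n r s j i)"
  by (simp add: pairing_def)

context two_parameter_so_root_of_unity
begin

lemma opposite_two_parameter_so:
  "two_parameter_so_root_of_unity (opposite_scale scale) n l s r (\<lambda>i. Op (f i)) (\<lambda>i. Op (e i))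
    (\<lambda>i. Op (w' i)) (\<lambda>i. Op (wi' i)) (\<lambda>i. Op (w i)) (\<lambda>i. Op (wi i))"
proof -
  interpret opposite: scalar_algebra "opposite_scale scale"
    by (rule opposite_scalar_algebra)
  show ?thesis
  proof
    fix i j assume ranges: "i \<in> {1..n}" "j \<in> {1..n}"
    have pairing_nz: "pairing n r s i j \<noteq> 0" "pairing n r s j i \<noteq> 0"
      using r_nz s_nz by (auto simp: pairing_def)
    then show "opposite.qcommute (pairing n s r i j) (Op (w' j)) (Op (f i))"
      "opposite.qcommute (inverse (pairing n s r i j)) (Op (w' j)) (Op (e i))"
      "opposite.qcommute (inverse (pairing n s r j i)) (Op (w j)) (Op (f i))"
      "opposite.qcommute (pairing n s r j i) (Op (w j)) (Op (e i))"
      using w_e[OF ranges] w_f[OF ranges] w'_e[OF ranges] w'_f[OF ranges]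
        qcommute_inverse_iff[of "inverse (pairing n r s j i)" "e i" "w' j"]
        qcommute_inverse_iff[of "inverse (pairing n r s i j)" "f i" "w j"]
      by (simp_all add: opposite_qcommute pairing_swap[OF r_nz s_nz] qcommute_inverse_iff)
    show "opposite.qbracket (Op (f i)) (Op (e j)) 1 =
        (if i = j then opposite_scale scale (inverse (rr n s i - rr n r i)) (Op (w' i) - Op (w i))
          else 0)"
    proof -
      have "inverse (rr n s i - rr n r i) = - inverse (rr n r i - rr n s i)"
        by (simp flip: inverse_minus_eq)
      then show ?thesis
        using e_f[OF ranges(2,1)]
        by (auto simp: opposite_qbracket opposite_scale_def Op_simps scale_right_diff_distrib)
    qed
    assume "i \<noteq> j"
    then show "(left_adjoint (Op (f i)) (Op (w' i)) (Op (wi' i)) ^^ nat (1 - cartan n i j)) (Op (f j)) = 0"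
      "(right_adjoint (Op (e i)) (Op (w i)) (Op (wi i)) ^^ nat (1 - cartan n i j)) (Op (e j)) = 0"
      using serre_e[OF ranges] serre_f[OF ranges]
      by (simp_all add: left_adjoint_funpow_Op right_adjoint_funpow_Op Op_simps)
  qed (use l_pos r_root s_root cubes_ne fourth_powers_ne in
      \<open>simp_all add: Op_simps w_wi w'_wi' opposite_qcommute w_w w_w' w'_w' qcommute_1_sym\<close>)
qed

end

section \<open>The algebra as a factor of a ring type\<close>

lemma ideal_gen_uminus: "x \<in> ideal_gen J \<Longrightarrow> - x \<in> ideal_gen J"
  using ideal_gen.mult[of x J "- 1" 1] by simp

lemma ideal_gen_diff: "x \<in> ideal_gen J \<Longrightarrow> y \<in> ideal_gen J \<Longrightarrow> x - y \<in> ideal_gen J"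
  using ideal_gen.add[OF _ ideal_gen_uminus] by fastforce

lemma ideal_gen_mult_left: "x \<in> ideal_gen J \<Longrightarrow> a * x \<in> ideal_gen J"
  using ideal_gen.mult[of x J a 1] by simp

lemma ideal_gen_mult_right: "x \<in> ideal_gen J \<Longrightarrow> x * b \<in> ideal_gen J"
  using ideal_gen.mult[of x J 1 b] by simp

lemma ideal_gen_empty: "x \<in> ideal_gen {} \<Longrightarrow> x = 0"
  by (induction rule: ideal_gen.induct) auto

lemma ideal_gen_cong:
  assumes "a - a' \<in> ideal_gen J"
  shows "- a - - a' \<in> ideal_gen J"
    and "b - b' \<in> ideal_gen J \<Longrightarrow> (a + b) - (a' + b') \<in> ideal_gen J"
    and "b - b' \<in> ideal_gen J \<Longrightarrow> (a - b) - (a' - b') \<in> ideal_gen J"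
    and "b - b' \<in> ideal_gen J \<Longrightarrow> a * b - a' * b' \<in> ideal_gen J"
proof -
  have differences: "- a - - a' = - (a - a')" "(a + b) - (a' + b') = (a - a') + (b - b')"
    "(a - b) - (a' - b') = (a - a') - (b - b')" "a * b - a' * b' = (a - a') * b + a' * (b - b')"
    by (simp_all add: algebra_simps)
  show "- a - - a' \<in> ideal_gen J"
    unfolding differences using assms by (rule ideal_gen_uminus)
  assume b_diff: "b - b' \<in> ideal_gen J"
  show "(a + b) - (a' + b') \<in> ideal_gen J"
    unfolding differences using assms b_diff by (rule ideal_gen.add)
  show "(a - b) - (a' - b') \<in> ideal_gen J"
    unfolding differences using assms b_diff by (rule ideal_gen_diff)
  show "a * b - a' * b' \<in> ideal_gen J"
    unfolding differences
    using assms b_diff by (intro ideal_gen.add ideal_gen_mult_left ideal_gen_mult_right)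
qed

text \<open>A type cannot depend on the ideal, so all quotients of the ring by ideals \<open>ideal_gen J\<close> are
  collected into one ring, their product over all \<open>J\<close>.\<close>

quotient_type (overloaded) 'b all_quotients = "'b::ring_1 set \<Rightarrow> 'b" /
  "\<lambda>g h. \<forall>J. g J - h J \<in> ideal_gen J"
proof (rule equivpI)
  show "reflp (\<lambda>g h. \<forall>J. g J - h J \<in> ideal_gen J)"
    by (rule reflpI) (simp add: ideal_gen.zero)
  show "symp (\<lambda>g h. \<forall>J. g J - h J \<in> ideal_gen J)"
    by (rule sympI) (metis ideal_gen_uminus minus_diff_eq)
  show "transp (\<lambda>g h. \<forall>J. g J - h J \<in> ideal_gen J)"
    by (rule transpI) (metis ideal_gen.add diff_add_cancel add_diff_eq)
qed

instantiation all_quotients :: (ring_1) ring_1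
begin

lift_definition zero_all_quotients :: "'a all_quotients" is "\<lambda>J. 0" .
lift_definition one_all_quotients :: "'a all_quotients" is "\<lambda>J. 1" .
lift_definition uminus_all_quotients :: "'a all_quotients \<Rightarrow> 'a all_quotients" is "\<lambda>g J. - g J"
  using ideal_gen_cong(1) by blast
lift_definition plus_all_quotients :: "'a all_quotients \<Rightarrow> 'a all_quotients \<Rightarrow> 'a all_quotients"
  is "\<lambda>g h J. g J + h J"
  using ideal_gen_cong(2) by blast
lift_definition minus_all_quotients :: "'a all_quotients \<Rightarrow> 'a all_quotients \<Rightarrow> 'a all_quotients"
  is "\<lambda>g h J. g J - h J"
  using ideal_gen_cong(3) by blast
lift_definition times_all_quotients :: "'a all_quotients \<Rightarrow> 'a all_quotients \<Rightarrow> 'a all_quotients"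
  is "\<lambda>g h J. g J * h J"
  using ideal_gen_cong(4) by blast

instance
proof
  show "(0 :: 'a all_quotients) \<noteq> 1"
  proof (transfer, rule notI)
    assume "\<forall>J. (0 :: 'a) - 1 \<in> ideal_gen J"
    then have "(0 :: 'a) - 1 = 0" using ideal_gen_empty by blast
    then show False by simp
  qed
qed (transfer, simp add: ideal_gen.zero algebra_simps)+

end

lift_definition quot :: "'b::ring_1 set \<Rightarrow> 'b \<Rightarrow> 'b all_quotients"
  is "\<lambda>J x K. if K = J then x else 0" .

lemma quot_0: "quot J 0 = 0"
  and quot_diff: "quot J (x - y) = quot J x - quot J y"
  and quot_mult: "quot J (x * y) = quot J x * quot J y"
  by (transfer, simp add: ideal_gen.zero)+

lemma quot_eq_iff: "quot J x = quot J y \<longleftrightarrow> x - y \<in> ideal_gen J"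
  by transfer (auto simp: ideal_gen.zero)

lemma quot_eq_0: "x \<in> J \<Longrightarrow> quot J x = 0"
  using quot_eq_iff[of J x 0] by (simp add: quot_0 ideal_gen.base)

lift_definition left_mult :: "'b::ring_1 \<Rightarrow> 'b all_quotients \<Rightarrow> 'b all_quotients" is "\<lambda>x g J. x * g J"
  by (simp add: ideal_gen_mult_left flip: right_diff_distrib)

lemma left_mult_module:
  "left_mult x (y + z) = left_mult x y + left_mult x z"
  "left_mult (x + x') y = left_mult x y + left_mult x' y"
  "left_mult (x * x') y = left_mult x (left_mult x' y)"
  "left_mult 1 y = y"
  by (transfer, simp add: ideal_gen.zero algebra_simps)+

lemma left_mult_times: "left_mult x y * z = left_mult x (y * z)"
  by transfer (simp add: ideal_gen.zero mult.assoc)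

lemma left_mult_central:
  assumes "\<And>a. x * a = a * x"
  shows "y * left_mult x z = left_mult x (y * z)"
  using assms by transfer (simp add: ideal_gen.zero flip: mult.assoc)

lemma left_mult_quot: "quot J (x * y) = left_mult x (quot J y)"
  by transfer (simp add: ideal_gen.zero)

text \<open>The embedding of one quotient is not unital. The images of units are completed by
  \<open>1 - quot J 1\<close> so that they become units of the product ring.\<close>

definition quot1 :: "'b::ring_1 set \<Rightarrow> 'b \<Rightarrow> 'b all_quotients" where
  "quot1 J x = quot J x + (1 - quot J 1)"

lemma quot1_mult_quot: "quot1 J x * quot J y = quot J (x * y)"
  and quot_mult_quot1: "quot J x * quot1 J y = quot J (x * y)"
  and quot1_mult: "quot1 J x * quot1 J y = quot1 J (x * y)"
  by (simp_all add: quot1_def algebra_simps flip: quot_mult)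

lemma quot1_1: "quot1 J 1 = 1"
  by (simp add: quot1_def)

lemma quot1_diff: "quot1 J x - quot1 J y = quot J (x - y)"
  by (simp add: quot1_def quot_diff)

lemma quot1_eqI: "x - y \<in> J \<Longrightarrow> quot1 J x = quot1 J y"
  using quot1_diff[of J x y] by (simp add: quot_eq_0)

definition represents :: "'b::ring_1 set \<Rightarrow> 'b all_quotients \<Rightarrow> 'b \<Rightarrow> bool" where
  "represents J y x \<longleftrightarrow> (\<forall>z. y * quot J z = quot J (x * z) \<and> quot J z * y = quot J (z * x))"

lemma represents_quot: "represents J (quot J x) x"
  by (simp add: represents_def quot_mult)

lemma represents_quot1: "represents J (quot1 J x) x"
  by (simp add: represents_def quot1_mult_quot quot_mult_quot1)

lemma represents_power:
  assumes "represents J y x"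
  shows "represents J (y ^ m) (x ^ m)"
proof (induction m)
  case (Suc m)
  have "quot J z * (y * y ^ m) = quot J (z * (x * x ^ m))" for z
    using assms Suc by (simp add: represents_def flip: mult.assoc)
  then show ?case using assms Suc by (simp add: represents_def mult.assoc)
qed (simp add: represents_def)

lemma quot_commute_if_represents:
  assumes "represents J y x" "y * quot1 J v = quot1 J v * y"
  shows "quot J (x * v) = quot J (v * x)"
proof -
  have "quot J (x * v) = y * quot1 J v * quot J 1"
    using assms(1) by (simp add: represents_def quot1_mult_quot mult.assoc)
  also have "\<dots> = quot1 J v * (y * quot J 1)"
    by (simp add: assms(2) mult.assoc)
  also have "\<dots> = quot J (v * x)"
    using assms(1) by (simp add: represents_def quot1_mult_quot)
  finally show ?thesis .
qed

lemma commute_right_inverse: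
  fixes a b c :: "'a::monoid_mult"
  assumes "a * b = b * a" "b * c = 1" "c * b = 1"
  shows "a * c = c * a"
proof -
  have "c * a = c * (a * b) * c" using assms(2) by (simp add: mult.assoc)
  also have "\<dots> = c * b * a * c" using assms(1) by (simp add: mult.assoc)
  finally show ?thesis using assms(3) by simp
qed

section \<open>Scalars and generators of the free algebra\<close>

lemma free_algebra_induct [case_names add scalar gen]:
  fixes x :: "'k::field freealg"
  assumes add: "\<And>x y. P x \<Longrightarrow> P y \<Longrightarrow> P (x + y)" and scalar: "\<And>c. P (sc c)"
    and gen: "\<And>g x. P x \<Longrightarrow> P (gn g * x)"
  shows "P x"
proof -
  have single: "P (Poly_Mapping.single (Word gs) c)" for gs c
  proof (induction gs)
    case Nil
    show ?case using scalar by (simp add: sc_def)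
  next
    case (Cons g gs)
    have "Poly_Mapping.single (Word (g # gs)) c = gn g * Poly_Mapping.single (Word gs) c"
      by (simp add: gn_def mult_single)
    then show ?case using gen[OF Cons] by simp
  qed
  show ?thesis
  proof (induction x rule: update_induct)
    case const
    show ?case using scalar[of 0] by (simp add: sc_def)
  next
    case (update f a b)
    have "Poly_Mapping.update a b f = f + Poly_Mapping.single a b"
      using update
      by (intro poly_mapping_eqI)
        (auto simp: lookup_update lookup_add lookup_single in_keys_iff when_def)
    then show ?case using add[OF update(3) single] by (cases a) simp
  qed
qed

lemma sc_add: "sc (a + b) = sc a + sc b"
  by (simp add: sc_def single_add)

lemma sc_mult: "sc (a * b) = sc a * sc b"
  by (simp add: sc_def mult_single)

lemma sc_1: "sc 1 = 1"
  using single_one[where 'a = word] by (simp add: sc_def zero_word_def)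

lemma sc_central:
  fixes x :: "'k::field freealg"
  shows "sc c * x = x * sc c"
proof (induction x rule: free_algebra_induct)
  case (add x y)
  then show ?case by (simp add: algebra_simps)
next
  case (scalar d)
  show ?case by (simp add: mult.commute flip: sc_mult)
next
  case (gen g x)
  have "sc c * gn g = gn g * sc c" by (simp add: sc_def gn_def mult_single)
  then have "sc c * (gn g * x) = gn g * (sc c * x)" by (simp flip: mult.assoc)
  then show ?case using gen by (simp add: mult.assoc)
qed

definition quot_scale :: "'k::field \<Rightarrow> 'k freealg all_quotients \<Rightarrow> 'k freealg all_quotients" where
  "quot_scale c = left_mult (sc c)"

lemma quot_sc_mult: "quot J (sc c * x) = quot_scale c (quot J x)"
  by (simp add: quot_scale_def left_mult_quot)

lemma quot_scalar_algebra: "scalar_algebra quot_scale"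
  by standard (simp_all add: quot_scale_def left_mult_module left_mult_times
      left_mult_central[OF sc_central] sc_add sc_mult sc_1)

lemma Ucentral_if_generators:
  assumes "\<And>g. gen_idx g \<in> {1..n} \<Longrightarrow> x * gn g - gn g * x \<in> ideal_gen (rels n r s)"
  shows "Ucentral n r s x"
  unfolding Ucentral_def
proof
  fix y
  have commutator_gn: "x * gn g - gn g * x \<in> ideal_gen (rels n r s)" for g
  proof (cases "gen_idx g \<in> {1..n}")
    case False
    then have "gn g \<in> rels n r s" by (auto simp: rels_def)
    then have "gn g \<in> ideal_gen (rels n r s)" by (rule ideal_gen.base)
    then show ?thesis by (intro ideal_gen_diff ideal_gen_mult_left ideal_gen_mult_right)
  qed (rule assms)
  show "x * y - y * x \<in> ideal_gen (rels n r s)"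
  proof (induction y rule: free_algebra_induct)
    case (add y z)
    have "x * (y + z) - (y + z) * x = (x * y - y * x) + (x * z - z * x)"
      by (simp add: algebra_simps)
    then show ?case using ideal_gen.add[OF add] by simp
  next
    case (scalar c)
    show ?case by (simp add: sc_central ideal_gen.zero)
  next
    case (gen h y)
    have "x * (gn h * y) - gn h * y * x = (x * gn h - gn h * x) * y + gn h * (x * y - y * x)"
      by (simp add: algebra_simps)
    then show ?case
      using commutator_gn gen by (simp add: ideal_gen.add ideal_gen_mult_left ideal_gen_mult_right)
  qed
qed

lemma Ucentral_diff_1: "Ucentral n r s x \<Longrightarrow> Ucentral n r s (x - 1)"
  by (simp add: Ucentral_def algebra_simps)

lemma Ev_rec:
  assumes "k < j"
  shows "Ev r k j = ge k * Ev r (Suc k) j - sc (r^2) * Ev r (Suc k) j * ge k"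
proof -
  have "j - k = Suc (j - Suc k)" "j - Suc (j - Suc k) = k" using assms by simp_all
  then show ?thesis by (simp add: Ev_def)
qed

lemma Epv_rec:
  assumes "j < n"
  shows "Epv n r s k j = Epv n r s k (Suc j) * ge j - sc (inverse (s^2)) * ge j * Epv n r s k (Suc j)"
proof -
  have "n - j = Suc (n - Suc j)" "n - Suc (n - Suc j) = j" using assms by simp_all
  then show ?thesis by (simp add: Epv_def)
qed

lemma Fv_rec:
  assumes "k < j"
  shows "Fv s k j = Fv s (Suc k) j * gf k - sc (s^2) * gf k * Fv s (Suc k) j"
proof -
  have "j - k = Suc (j - Suc k)" "j - Suc (j - Suc k) = k" using assms by simp_all
  then show ?thesis by (simp add: Fv_def)
qed

lemma Fpv_rec:
  assumes "j < n"
  shows "Fpv n r s k j = gf j * Fpv n r s k (Suc j) - sc (inverse (r^2)) * Fpv n r s k (Suc j) * gf j"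
proof -
  have "n - j = Suc (n - Suc j)" "n - Suc (n - Suc j) = j" using assms by simp_all
  then show ?thesis by (simp add: Fpv_def)
qed

section \<open>Centrality of the \<open>l\<close>-th powers\<close>

lemma (in scalar_algebra) qcommute_if_conjugate:
  assumes "v * x * v' = c \<star> x" "v' * v = 1"
  shows "qcommute c v x"
proof -
  have "v * x = v * x * v' * v" using assms(2) by (simp add: mult.assoc)
  then show ?thesis by (simp add: assms(1) qcommute_def scale_mult_left)
qed

locale so_presentation =
  fixes n l :: nat and r s :: "'k::field"
  assumes l_pos: "l > 0" and r_root: "r ^ l = 1" and s_root: "s ^ l = 1"
    and cubes_ne: "r ^ 3 \<noteq> s ^ 3" and fourth_powers_ne: "r ^ 4 \<noteq> s ^ 4"
begin

sublocale quotients: scalar_algebra quot_scale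
  by (rule quot_scalar_algebra)

abbreviation \<pi> :: "'k freealg \<Rightarrow> 'k freealg all_quotients" where "\<pi> \<equiv> quot (rels n r s)"
abbreviation \<upsilon> :: "'k freealg \<Rightarrow> 'k freealg all_quotients" where "\<upsilon> \<equiv> quot1 (rels n r s)"

lemma \<pi>_qbracket: "\<pi> (x * y - sc c * y * x) = quotients.qbracket (\<pi> x) (\<pi> y) c"
  by (simp only: quotients.qbracket_def quot_diff quot_sc_mult mult.assoc) (simp only: quot_mult)

lemma \<upsilon>_inverse:
  assumes "i \<in> {1..n}"
  shows "\<upsilon> (gw i) * \<upsilon> (gwi i) = 1" "\<upsilon> (gwi i) * \<upsilon> (gw i) = 1"
    "\<upsilon> (gw' i) * \<upsilon> (gw'i i) = 1" "\<upsilon> (gw'i i) * \<upsilon> (gw' i) = 1"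
proof -
  have "gw i * gwi i - 1 \<in> rels n r s" "gwi i * gw i - 1 \<in> rels n r s"
    "gw' i * gw'i i - 1 \<in> rels n r s" "gw'i i * gw' i - 1 \<in> rels n r s"
    unfolding rels_def using assms by blast+
  from this[THEN quot1_eqI] show "\<upsilon> (gw i) * \<upsilon> (gwi i) = 1" "\<upsilon> (gwi i) * \<upsilon> (gw i) = 1"
    "\<upsilon> (gw' i) * \<upsilon> (gw'i i) = 1" "\<upsilon> (gw'i i) * \<upsilon> (gw' i) = 1"
    by (simp_all add: quot1_mult quot1_1)
qed

lemma \<upsilon>_commute:
  assumes "i \<in> {1..n}" "j \<in> {1..n}"
  shows "quotients.qcommute 1 (\<upsilon> (gw i)) (\<upsilon> (gw j))" "quotients.qcommute 1 (\<upsilon> (gw i)) (\<upsilon> (gw' j))"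
    "quotients.qcommute 1 (\<upsilon> (gw' i)) (\<upsilon> (gw' j))"
proof -
  have "gw i * gw j - gw j * gw i \<in> rels n r s" "gw i * gw' j - gw' j * gw i \<in> rels n r s"
    "gw' i * gw' j - gw' j * gw' i \<in> rels n r s"
    unfolding rels_def using assms by blast+
  from this[THEN quot1_eqI] show "quotients.qcommute 1 (\<upsilon> (gw i)) (\<upsilon> (gw j))"
    "quotients.qcommute 1 (\<upsilon> (gw i)) (\<upsilon> (gw' j))" "quotients.qcommute 1 (\<upsilon> (gw' i)) (\<upsilon> (gw' j))"
    by (simp_all add: quot1_mult quotients.qcommute_1_iff)
qed

lemma \<upsilon>_qcommute_\<pi>:
  assumes "v * x * v' - sc c * x \<in> rels n r s" "\<upsilon> v' * \<upsilon> v = 1"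
  shows "quotients.qcommute c (\<upsilon> v) (\<pi> x)"
proof (rule quotients.qcommute_if_conjugate)
  show "\<upsilon> v * \<pi> x * \<upsilon> v' = quot_scale c (\<pi> x)"
    using quot_eq_0[OF assms(1)]
    by (simp add: quot_diff quot_sc_mult quot1_mult_quot quot_mult_quot1)
qed (fact assms(2))

lemma \<upsilon>_qcommute_generators:
  assumes "i \<in> {1..n}" "j \<in> {1..n}"
  shows "quotients.qcommute (pairing n r s i j) (\<upsilon> (gw j)) (\<pi> (ge i))"
    and "quotients.qcommute (inverse (pairing n r s i j)) (\<upsilon> (gw j)) (\<pi> (gf i))"
    and "quotients.qcommute (inverse (pairing n r s j i)) (\<upsilon> (gw' j)) (\<pi> (ge i))"
    and "quotients.qcommute (pairing n r s j i) (\<upsilon> (gw' j)) (\<pi> (gf i))"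
proof -
  have "gw j * ge i * gwi j - sc (pairing n r s i j) * ge i \<in> rels n r s"
    "gw j * gf i * gwi j - sc (inverse (pairing n r s i j)) * gf i \<in> rels n r s"
    "gw' j * ge i * gw'i j - sc (inverse (pairing n r s j i)) * ge i \<in> rels n r s"
    "gw' j * gf i * gw'i j - sc (pairing n r s j i) * gf i \<in> rels n r s"
    unfolding rels_def using assms by blast+
  from this[THEN \<upsilon>_qcommute_\<pi>] show "quotients.qcommute (pairing n r s i j) (\<upsilon> (gw j)) (\<pi> (ge i))"
    "quotients.qcommute (inverse (pairing n r s i j)) (\<upsilon> (gw j)) (\<pi> (gf i))"
    "quotients.qcommute (inverse (pairing n r s j i)) (\<upsilon> (gw' j)) (\<pi> (ge i))"
    "quotients.qcommute (pairing n r s j i) (\<upsilon> (gw' j)) (\<pi> (gf i))"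
    using \<upsilon>_inverse[OF assms(2)] by simp_all
qed

lemma \<pi>_e_f:
  assumes "i \<in> {1..n}" "j \<in> {1..n}"
  shows "quotients.qbracket (\<pi> (ge i)) (\<pi> (gf j)) 1
    = (if i = j then quot_scale (inverse (rr n r i - rr n s i)) (\<upsilon> (gw i) - \<upsilon> (gw' i)) else 0)"
proof -
  have "ge i * gf j - gf j * ge i
      - (if i = j then sc (inverse (rr n r i - rr n s i)) * (gw i - gw' i) else 0) \<in> rels n r s"
    unfolding rels_def using assms by blast
  then have "\<pi> (ge i * gf j - gf j * ge i)
      = \<pi> (if i = j then sc (inverse (rr n r i - rr n s i)) * (gw i - gw' i) else 0)"
    by (simp only: quot_eq_iff ideal_gen.base)
  moreover have "quotients.qbracket (\<pi> (ge i)) (\<pi> (gf j)) 1 = \<pi> (ge i * gf j - gf j * ge i)"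
    by (simp add: quotients.qbracket_def quot_diff quot_mult)
  ultimately show ?thesis by (simp add: quot_0 quot_sc_mult quot1_diff)
qed

lemma \<pi>_serre:
  assumes "i \<in> {1..n}" "j \<in> {1..n}" "i \<noteq> j"
  shows "(left_adjoint (\<pi> (ge i)) (\<upsilon> (gw i)) (\<upsilon> (gwi i)) ^^ nat (1 - cartan n i j)) (\<pi> (ge j)) = 0"
    and "(right_adjoint (\<pi> (gf i)) (\<upsilon> (gw' i)) (\<upsilon> (gw'i i)) ^^ nat (1 - cartan n i j)) (\<pi> (gf j)) = 0"
proof -
  have adjoint: "(left_adjoint (\<pi> (ge i)) (\<upsilon> (gw i)) (\<upsilon> (gwi i)) ^^ m) (\<pi> x) = \<pi> ((adl i ^^ m) x)"
    "(right_adjoint (\<pi> (gf i)) (\<upsilon> (gw' i)) (\<upsilon> (gw'i i)) ^^ m) (\<pi> x) = \<pi> ((adr i ^^ m) x)" for m x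
    by (induction m)
      (simp_all add: left_adjoint_def adl_def right_adjoint_def adr_def quot_diff quot_mult_quot1
        quot1_mult_quot flip: quot_mult)
  have "(adl i ^^ nat (1 - cartan n i j)) (ge j) \<in> rels n r s"
    "(adr i ^^ nat (1 - cartan n i j)) (gf j) \<in> rels n r s"
    unfolding rels_def
    by (rule UnI2, rule UN_I[OF assms(1)], rule UN_I[OF assms(2)], use assms(3) in simp)+
  then show "(left_adjoint (\<pi> (ge i)) (\<upsilon> (gw i)) (\<upsilon> (gwi i)) ^^ nat (1 - cartan n i j)) (\<pi> (ge j)) = 0"
    "(right_adjoint (\<pi> (gf i)) (\<upsilon> (gw' i)) (\<upsilon> (gw'i i)) ^^ nat (1 - cartan n i j)) (\<pi> (gf j)) = 0"
    unfolding adjoint by (simp_all only: quot_eq_0)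
qed

sublocale U: two_parameter_so_root_of_unity quot_scale n l r s "\<lambda>i. \<pi> (ge i)" "\<lambda>i. \<pi> (gf i)"
  "\<lambda>i. \<upsilon> (gw i)" "\<lambda>i. \<upsilon> (gwi i)" "\<lambda>i. \<upsilon> (gw' i)" "\<lambda>i. \<upsilon> (gw'i i)"
  by standard
    (use l_pos r_root s_root cubes_ne fourth_powers_ne \<upsilon>_inverse \<upsilon>_commute \<upsilon>_qcommute_generators
      \<pi>_e_f \<pi>_serre in simp_all)

sublocale Uop: two_parameter_so_root_of_unity "opposite_scale quot_scale" n l s r
  "\<lambda>i. Op (\<pi> (gf i))" "\<lambda>i. Op (\<pi> (ge i))"
  "\<lambda>i. Op (\<upsilon> (gw' i))" "\<lambda>i. Op (\<upsilon> (gw'i i))" "\<lambda>i. Op (\<upsilon> (gw i))" "\<lambda>i. Op (\<upsilon> (gwi i))"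
  by (rule U.opposite_two_parameter_so)

lemma \<pi>_Ev: "k \<le> j \<Longrightarrow> \<pi> (Ev r k j) = U.E k j"
proof (induction rule: inc_induct)
  case base
  show ?case by (simp add: Ev_def)
next
  case (step k)
  then show ?case by (simp add: Ev_rec U.E_left \<pi>_qbracket)
qed

lemma \<pi>_Fv: "k \<le> j \<Longrightarrow> Op (\<pi> (Fv s k j)) = Uop.E k j"
proof (induction rule: inc_induct)
  case base
  show ?case by (simp add: Fv_def)
next
  case (step k)
  then show ?case
    by (simp add: Fv_rec Uop.E_left \<pi>_qbracket quotients.opposite_qbracket flip: step.IH)
qed

lemma \<pi>_Epv:
  assumes "k < j" "j \<le> n"
  shows "\<pi> (Epv n r s k j) = U.E' k j"
  using assms(2,1)
proof (induction rule: inc_induct)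
  case base
  then show ?case by (simp add: Epv_def U.E'_step U.bracket_scalar_def \<pi>_qbracket \<pi>_Ev)
next
  case (step j)
  then show ?case by (simp add: Epv_rec U.E'_step[of j] U.bracket_scalar_def \<pi>_qbracket)
qed

lemma \<pi>_Fpv:
  assumes "k < j" "j \<le> n"
  shows "Op (\<pi> (Fpv n r s k j)) = Uop.E' k j"
  using assms(2,1)
proof (induction rule: inc_induct)
  case base
  then show ?case
    by (simp add: Fpv_def Uop.E'_step Uop.bracket_scalar_def \<pi>_qbracket quotients.opposite_qbracket
      mult.commute[of r s] flip: \<pi>_Fv)
next
  case (step j)
  then show ?case
    by (simp add: Fpv_rec Uop.E'_step[of j] Uop.bracket_scalar_def \<pi>_qbracket
      quotients.opposite_qbracket flip: step.IH)
qed

lemma Ucentral_if_commutes_with_generators: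
  assumes "represents (rels n r s) y x" "U.commutes_with_generators y"
  shows "Ucentral n r s x"
proof (rule Ucentral_if_generators)
  fix g assume gen_range: "gen_idx g \<in> {1..n}"
  define i where "i = gen_idx g"
  have i_range: "i \<in> {1..n}" using gen_range by (simp add: i_def)
  have y_commutes: "y * \<pi> (ge i) = \<pi> (ge i) * y" "y * \<pi> (gf i) = \<pi> (gf i) * y"
    "y * \<upsilon> (gw i) = \<upsilon> (gw i) * y" "y * \<upsilon> (gw' i) = \<upsilon> (gw' i) * y"
    using assms(2) i_range
    by (simp_all add: U.commutes_with_generators_def quotients.qcommute_1_iff)
  have "\<pi> (x * ge i) = \<pi> (ge i * x)" "\<pi> (x * gf i) = \<pi> (gf i * x)"
    using assms(1) y_commutes(1,2) by (simp_all add: represents_def)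
  moreover have "y * \<upsilon> (gwi i) = \<upsilon> (gwi i) * y" "y * \<upsilon> (gw'i i) = \<upsilon> (gw'i i) * y"
    using commute_right_inverse y_commutes(3,4) \<upsilon>_inverse[OF i_range] by blast+
  then have "\<pi> (x * v) = \<pi> (v * x)" if "v \<in> {gw i, gwi i, gw' i, gw'i i}" for v
    using quot_commute_if_represents[OF assms(1)] y_commutes(3,4) that by blast
  ultimately have "\<pi> (x * gn g) = \<pi> (gn g * x)"
    by (cases g) (simp_all add: i_def gen_idx_def)
  then show "x * gn g - gn g * x \<in> ideal_gen (rels n r s)"
    by (simp only: quot_eq_iff)
qed

lemma commutes_with_generators_if_opposite:
  "Uop.commutes_with_generators (Op y) \<Longrightarrow> U.commutes_with_generators y"
  by (simp add: Uop.commutes_with_generators_def U.commutes_with_generators_def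
    quotients.opposite_qcommute quotients.qcommute_1_sym)

lemma Ucentral_power_if_commutes_with_generators:
  assumes "U.commutes_with_generators (\<pi> x ^ m) \<or> Uop.commutes_with_generators (Op (\<pi> x) ^ m)"
  shows "Ucentral n r s (x ^ m)"
  using assms Ucentral_if_commutes_with_generators[OF represents_power[OF represents_quot]]
    commutes_with_generators_if_opposite[of "\<pi> x ^ m"] by (auto simp: Op_power)

lemma Ucentral_Ev_Fv_power:
  assumes "1 \<le> k" "k \<le> j" "j \<le> n"
  shows "Ucentral n r s (Ev r k j ^ l)" "Ucentral n r s (Fv s k j ^ l)"
  by (rule Ucentral_power_if_commutes_with_generators,
      use U.E_power_commutes_with_generators[OF assms]
        Uop.E_power_commutes_with_generators[OF assms] assms(2)
      in \<open>simp add: \<pi>_Ev \<pi>_Fv\<close>)+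

lemma Ucentral_Epv_Fpv_power:
  assumes "1 \<le> k" "k < j" "j \<le> n"
  shows "Ucentral n r s (Epv n r s k j ^ l)" "Ucentral n r s (Fpv n r s k j ^ l)"
  by (rule Ucentral_power_if_commutes_with_generators,
      use U.E'_power_commutes_with_generators[OF assms]
        Uop.E'_power_commutes_with_generators[OF assms] assms(2,3)
      in \<open>simp add: \<pi>_Epv \<pi>_Fpv\<close>)+

lemma Ucentral_gw_power:
  assumes "1 \<le> k" "k \<le> n"
  shows "Ucentral n r s (gw k ^ l)" "Ucentral n r s (gw' k ^ l)"
  using U.w_power_commutes_with_generators[OF assms] represents_power[OF represents_quot1]
    Ucentral_if_commutes_with_generators by blast+

end

lemma power_eq_1_if_dvd: "x ^ d = 1 \<Longrightarrow> d dvd m \<Longrightarrow> x ^ m = (1 :: 'a::monoid_mult)"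
  by (auto elim!: dvdE simp: power_mult)

theorem theorem3p15:
  fixes r s :: "'k::field_char_0" and n d d' :: nat
  assumes "n \<ge> 2"
    and "primitive_root d r" and "primitive_root d' s"
    and "r ^ 3 \<noteq> s ^ 3" and "r ^ 4 \<noteq> s ^ 4"
  shows "(\<forall>k j. 1 \<le> k \<and> k \<le> j \<and> j \<le> n \<longrightarrow>
            Ucentral n r s (Ev r k j ^ lcm d d') \<and> Ucentral n r s (Fv s k j ^ lcm d d'))
       \<and> (\<forall>k j. 1 \<le> k \<and> k < j \<and> j \<le> n \<longrightarrow>
            Ucentral n r s (Epv n r s k j ^ lcm d d') \<and> Ucentral n r s (Fpv n r s k j ^ lcm d d'))
       \<and> (\<forall>k. 1 \<le> k \<and> k \<le> n \<longrightarrow>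
            Ucentral n r s (gw k ^ lcm d d' - 1) \<and> Ucentral n r s (gw' k ^ lcm d d' - 1))"
proof -
  have roots: "d > 0" "d' > 0" "r ^ d = 1" "s ^ d' = 1"
    using assms(2,3) by (auto simp: primitive_root_def)
  interpret so_presentation n "lcm d d'" r s
  proof
    show "lcm d d' > 0" using roots by (simp add: lcm_pos_nat)
    show "r ^ lcm d d' = 1" "s ^ lcm d d' = 1"
      using roots power_eq_1_if_dvd dvd_lcm1 dvd_lcm2 by blast+
  qed (fact assms)+
  show ?thesis
    using Ucentral_Ev_Fv_power Ucentral_Epv_Fpv_power Ucentral_gw_power[THEN Ucentral_diff_1] by
      blast
qed

end
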